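(* Let $\xi\in[0,1)$, $a=-2\log(1+\xi)$, $b=-2\log(1-\xi)$, and $x\in[a,b]$. The $q$-Bessel kernel is asymptotic to the sine kernel in the following limit (the bulk scaling limit): $$\lim_{q\to1}K_{q\mathrm{B}}\Big(-\frac{x}{\log q}+u,\,-\frac{x}{\log q}+v\Big)=\begin{cases}\dfrac{\sin\pi\varrho(u-v)}{\pi(u-v)}&(u\ne v),\\[1ex]\varrho&(u=v),\end{cases}$$ where $\varrho=\varrho(x)\in[0,1]$ is the bulk one-point function $$\varrho(x)=\frac1\pi\arccos\frac12\Big(\xi+\frac{1-e^{-x}}\xi\Big),\qquad x\in[a,b].$$
   Context: For $q,\xi\in[0,1)$ the $q$-Bessel kernel is $$K_{q\mathrm{B}}(r,s)=\xi\,\frac{J_{r+\frac12}J_{s-\frac12}-J_{r-\frac12}J_{s+\frac12}}{q^{\frac12(r-s)}-q^{-\frac12(r-s)}},\qquad r,s\in\mathbb{Z}+\tfrac12,$$ with $J_n=J^{(3)}_n(2\xi;q)$; this quotient is the closed form of the series $q^{\frac12(r+s)}\sum_{k\in\{\frac12,\frac32,\dots\}}q^kJ_{r+k}J_{s+k}$. Here, with $(a;q)_n=\prod_{k=0}^{n-1}(1-aq^k)$ and $(a;q)_\infty=\prod_{k\ge0}(1-aq^k)$, the Hahn--Exton $q$-Bessel function is $$J^{(3)}_\nu(x;q)=\frac{(q^{\nu+1};q)_\infty}{(q;q)_\infty}\Big(\frac x2\Big)^\nu\sum_{k\ge0}\frac{(-1)^kq^{k(k-1)/2}}{(q;q)_k\,(q^{\nu+1};q)_k}\Big(\frac{qx^2}4\Big)^k,$$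 and for integer orders (including negative ones) it is given by the generating function $\dfrac{(qx/2z;q)_\infty}{(xz/2;q)_\infty}=\sum_{n\in\mathbb{Z}}z^nJ^{(3)}_n(x;q)$. In the limit, $\xi$, $x$, $u$, $v$ are fixed, and $u,v$ are the local coordinates of the two arguments around the macroscopic position $-x/\log q$.
   Formalization: The case ξ = 0 is excluded: there a = b = x = 0, ϱ involves 0/0, and K(u,u) is 1 for u<0 and 0 for u>0, so no value of ϱ works; the limit is over q in (0,1) for which both kernel arguments are half-integers. *)

theory Defs
  imports "HOL-Analysis.Analysis"
begin

definition qpochhammer_inf :: "complex \<Rightarrow> real \<Rightarrow> complex" where
  "qpochhammer_inf a q = (\<Prod>k. 1 - a * of_real q ^ k)"

text \<open>
  Hahn--Exton q-Bessel function of integer order \<open>n\<close>: the coefficient of \<open>z\<^sup>n\<close> in the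
  Laurent expansion of the generating function \<open>(q x / 2 z; q)\<^sub>\<infinity> / (x z / 2; q)\<^sub>\<infinity>\<close>, which is
  holomorphic on the punctured disc \<open>0 < \<bar>x z / 2\<bar> < 1\<close>; the coefficients are unique by
  uniqueness of Laurent expansions.  For \<open>n \<ge> 0\<close> they are given by the series
  \<open>(q\<^sup>n\<^sup>+\<^sup>1; q)\<^sub>\<infinity> / (q; q)\<^sub>\<infinity> (x / 2)\<^sup>n (\<Sum>k. (-1)\<^sup>k q\<^sup>k\<^sup>(\<^sup>k\<^sup>-\<^sup>1\<^sup>)\<^sup>/\<^sup>2 (q x\<^sup>2 / 4)\<^sup>k / ((q; q)\<^sub>k (q\<^sup>n\<^sup>+\<^sup>1; q)\<^sub>k))\<close>.
\<close>

definition hahn_exton_J :: "real \<Rightarrow> real \<Rightarrow> int \<Rightarrow> real" where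
  "hahn_exton_J q x = (THE J. \<forall>z. z \<noteq> 0 \<and> norm (of_real x * z / 2) < 1 \<longrightarrow>
     ((\<lambda>n. z powi n * of_real (J n)) has_sum
       qpochhammer_inf (of_real q * of_real x / (2 * z)) q /
       qpochhammer_inf (of_real x * z / 2) q) UNIV)"

definition half_integers :: "real set" where
  "half_integers = {r. r - 1 / 2 \<in> \<int>}"

text \<open>
  The kernel is only meaningful for \<open>r\<close>, \<open>s\<close> half-integers, where all arguments of the
  floor function below are integers.  The quotient is \<open>0 / 0\<close> for \<open>r = s\<close>; there the kernel
  is given by the series of which the quotient is the closed form, summed over
  \<open>k = j + 1 / 2\<close> with \<open>j\<close> a natural number.
\<close>

definition q_bessel_kernel :: "real \<Rightarrow> real \<Rightarrow> real \<Rightarrow> real \<Rightarrow> real" where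
  "q_bessel_kernel q \<xi> r s =
    (let J = (\<lambda>t. hahn_exton_J q (2 * \<xi>) \<lfloor>t\<rfloor>) in
     if r = s then
       q powr ((r + s) / 2) *
         (\<Sum>j. q powr (real j + 1 / 2) * J (r + (real j + 1 / 2)) * J (s + (real j + 1 / 2)))
     else
       \<xi> * ((J (r + 1 / 2) * J (s - 1 / 2) - J (r - 1 / 2) * J (s + 1 / 2)) /
         (q powr ((r - s) / 2) - q powr (- ((r - s) / 2)))))"

definition bulk_density :: "real \<Rightarrow> real \<Rightarrow> real" where
  "bulk_density \<xi> x = 1 / pi * arccos (1 / 2 * (\<xi> + (1 - exp (- x)) / \<xi>))"

text \<open>
  The \<open>q \<in> (0, 1)\<close> for which both kernel arguments \<open>- x / log q + u\<close> and
  \<open>- x / log q + v\<close> lie on the lattice where the kernel is defined.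
\<close>

definition bulk_scaling_domain :: "real \<Rightarrow> real \<Rightarrow> real \<Rightarrow> real set" where
  "bulk_scaling_domain x u v =
    {q \<in> {0<..<1}. - x / ln q + u \<in> half_integers \<and> - x / ln q + v \<in> half_integers}"

end

theory Submission
  imports Defs
begin

text \<open>
  On \<open>\<bar>z\<bar> = 1\<close> the series \<open>\<Sum>\<^sub>n c\<^sub>n z\<^sup>n\<close> with \<open>c\<^sub>n = q\<^bsup>n/2\<^esup> J\<^sub>n\<close> takes values of modulus one, so the
  shifts of \<open>c\<close> are orthonormal, and the kernel is the Gram matrix of these shifts restricted to a half
  line.  The q-difference equation of the generating function says that the Toeplitz operator \<open>A\<close> with
  symbol \<open>1 + \<xi>\<^sup>2 - 2 \<xi> cos \<theta>\<close> acts on \<open>c\<close> asymptotically as multiplication by \<open>q\<^sup>n\<close>.  After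
  centering at \<open>n = - x / log q\<close> this weight is at most \<open>e\<^bsup>-x\<^esup>\<close> on the half line and at least \<open>e\<^bsup>-x\<^esup>\<close>
  on its complement, up to \<open>o(1)\<close>.  Both restrictions commute asymptotically with polynomials in \<open>A\<close>, so
  Weierstrass approximation shows that they converge to the spectral projections of \<open>A\<close> below and above
  \<open>e\<^bsup>-x\<^esup>\<close>; the level set of the symbol is a null set even at the edges \<open>x = a, b\<close>.
\<close>

subsection \<open>Laurent series on the unit circle\<close>

text \<open>The centred coefficient vectors vary with \<open>q\<close>, and no limit of them is ever
  taken. What stays fixed is their spectral measure: since the shifts are orthonormal for every
  \<open>q\<close>, pairing \<open>p(A)\<close> of one shift with another gives the same cosine
  integral of \<open>p(symbol)\<close> for all \<open>q\<close>, so only the cut at the half line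
  has to be understood. The cut is not a function of \<open>A\<close>, and comparing
  \<open>q powi n\<close> with its value at the centre gives only one-sided estimates. Two of them
  suffice: the mass on the half line and the mass on its complement are each bounded above by a
  spectral integral, while the masses add up to a constant and the two integrals to the same
  constant. The approximating polynomials enter as squares, because the sign of
  \<open>A - \<alpha>\<close> on a half line is known only for the quadratic form
  \<open>z -> <(A - \<alpha>) z, z>\<close>, taken at \<open>z = \<rho>(A) y\<close>. The method
  yields squared norms; off-diagonal entries of the kernel follow by polarization.\<close>

lemma infsum_norm_tail_small:
  fixes d :: "'a \<Rightarrow> 'b::banach"
  assumes "(\<lambda>n. norm (d n)) summable_on UNIV" "e > 0" "finite T"
  obtains S where "finite S" "T \<subseteq> S" "infsum (\<lambda>n. norm (d n)) (- S) < e"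
proof -
  obtain F where F: "finite F" "dist (sum (\<lambda>n. norm (d n)) F) (infsum (\<lambda>n. norm (d n)) UNIV) \<le> e / 2"
    using infsum_finite_approximation[OF assms(1), of "e/2"] assms(2) by auto
  define S where "S = F \<union> T"
  have fin: "finite S" using F(1) assms(3) by (simp add: S_def)
  have "infsum (\<lambda>n. norm (d n)) UNIV = infsum (\<lambda>n. norm (d n)) (S \<union> - S)"
    by simp
  also have "\<dots> = infsum (\<lambda>n. norm (d n)) S + infsum (\<lambda>n. norm (d n)) (- S)"
    by (rule infsum_Un_disjoint) (use assms(1) fin in \<open>auto intro: summable_on_subset_banach\<close>)
  finally have *: "infsum (\<lambda>n. norm (d n)) (- S) = infsum (\<lambda>n. norm (d n)) UNIV - sum (\<lambda>n. norm (d n)) S"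
    using fin by simp
  have "sum (\<lambda>n. norm (d n)) F \<le> sum (\<lambda>n. norm (d n)) S"
    by (rule sum_mono2) (use fin in \<open>auto simp: S_def\<close>)
  then have "infsum (\<lambda>n. norm (d n)) (- S) \<le> e / 2"
    using F(2) unfolding * dist_real_def by linarith
  then show thesis using that[of S] fin assms(2) by (auto simp: S_def)
qed

lemma has_integral_cis_int:
  "((\<lambda>t. cis (of_int n * t)) has_integral (if n = 0 then of_real (2 * pi) else 0)) {0..2*pi}"
proof (cases "n = 0")
  case True
  then show ?thesis
    using has_integral_const_real[of "1::complex" 0 "2*pi"] by (simp add: scaleR_conv_of_real)
next
  case False
  have "((\<lambda>t. cis (of_int n * t)) has_integral
      (cis (of_int n * (2*pi)) / (\<i> * of_int n) - cis (of_int n * 0) / (\<i> * of_int n))) {0..2*pi}"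
  proof (rule fundamental_theorem_of_calculus)
    fix t :: real
    have "((\<lambda>w. exp (\<i> * of_int n * w) / (\<i> * of_int n)) has_field_derivative
        exp (\<i> * of_int n * of_real t)) (at (of_real t))"
      using False by (auto intro!: derivative_eq_intros)
    then have "((\<lambda>t. exp (\<i> * of_int n * of_real t) / (\<i> * of_int n)) has_vector_derivative
        exp (\<i> * of_int n * of_real t)) (at t within {0..2*pi})"
      by (rule has_vector_derivative_real_field)
    then show "((\<lambda>t. cis (of_int n * t) / (\<i> * of_int n)) has_vector_derivative
        cis (of_int n * t)) (at t within {0..2*pi})"
      by (simp add: cis_conv_exp mult.assoc)
  qed simp
  moreover have "cis (of_int n * (2*pi)) = 1"
    using cis_power_int[of "2*pi" n] by simp
  ultimately show ?thesis using False by simp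
qed

text \<open>A Fourier coefficient argument on a finite truncation, so that no series is integrated
  termwise: integrating the partial sum over \<open>S\<close> against \<open>z powi (- m)\<close>
  leaves \<open>2 * pi * d m\<close>, while on the circle that partial sum equals minus the tail,
  which was chosen smaller than \<open>norm (d m)\<close>.\<close>

lemma laurent_zero_unique:
  fixes d :: "int \<Rightarrow> complex"
  assumes "\<And>z. norm z = 1 \<Longrightarrow> ((\<lambda>n. d n * z powi n) has_sum 0) UNIV"
  shows "d m = 0"
proof (rule ccontr)
  assume "d m \<noteq> 0"
  define e where "e = norm (d m)"
  have e: "e > 0" using \<open>d m \<noteq> 0\<close> by (simp add: e_def)
  have "(d has_sum 0) UNIV" using assms[of 1] by simp
  then have abs: "(\<lambda>n. norm (d n)) summable_on UNIV"
    using has_sum_imp_summable summable_on_iff_abs_summable_on_complex by blast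
  obtain S where S: "finite S" "m \<in> S" "infsum (\<lambda>n. norm (d n)) (- S) < e"
    using infsum_norm_tail_small[OF abs e, of "{m}"] by auto
  have bd: "norm (\<Sum>n\<in>S. d n * z powi n) \<le> infsum (\<lambda>n. norm (d n)) (- S)" if z: "norm z = 1" for z
  proof -
    have n: "norm (d n * z powi n) = norm (d n)" for n
      using z by (simp add: norm_mult norm_power_int)
    have sm: "(\<lambda>n. d n * z powi n) summable_on A" for A
      using assms[OF z] has_sum_imp_summable summable_on_subset_banach by blast
    have "0 = infsum (\<lambda>n. d n * z powi n) (S \<union> - S)"
      using assms[OF z] by (simp add: infsumI)
    also have "\<dots> = infsum (\<lambda>n. d n * z powi n) S + infsum (\<lambda>n. d n * z powi n) (- S)"
      by (rule infsum_Un_disjoint) (use sm in auto)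
    finally have "norm (\<Sum>n\<in>S. d n * z powi n) = norm (infsum (\<lambda>n. d n * z powi n) (- S))"
      using S(1) by (metis add.inverse_inverse eq_neg_iff_add_eq_0 infsum_finite norm_minus_cancel)
    also have "\<dots> \<le> infsum (\<lambda>n. norm (d n * z powi n)) (- S)"
      by (rule norm_infsum_bound) (use abs in \<open>auto simp: n intro: summable_on_subset_banach\<close>)
    finally show ?thesis by (simp add: n)
  qed
  have "((\<lambda>t. \<Sum>n\<in>S. d n * cis (of_int (n - m) * t)) has_integral
      (\<Sum>n\<in>S. d n * (if n - m = 0 then of_real (2 * pi) else 0))) {0..2*pi}"
    by (intro has_integral_sum S has_integral_mult_right has_integral_cis_int)
  also have "(\<Sum>n\<in>S. d n * (if n - m = 0 then complex_of_real (2 * pi) else 0)) = d m * of_real (2 * pi)"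
    using S by (simp add: sum.delta' if_distrib cong: if_cong)
  finally have "norm (d m * of_real (2 * pi)) \<le>
      infsum (\<lambda>n. norm (d n)) (- S) * measure lborel (cbox 0 (2*pi))"
  proof (intro has_integral_bound)
    fix t :: real
    have "(\<Sum>n\<in>S. d n * cis (of_int (n - m) * t)) = cis (- of_int m * t) * (\<Sum>n\<in>S. d n * cis t powi n)"
      unfolding sum_distrib_left
      by (intro sum.cong) (auto simp: cis_power_int cis_mult algebra_simps)
    then show "norm (\<Sum>n\<in>S. d n * cis (of_int (n - m) * t)) \<le> infsum (\<lambda>n. norm (d n)) (- S)"
      using bd[of "cis t"] by (simp add: norm_mult)
  qed (auto intro: infsum_nonneg)
  then have "e * (2 * pi) \<le> infsum (\<lambda>n. norm (d n)) (- S) * (2 * pi)"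
    by (simp add: e_def norm_mult)
  then show False using S(3) pi_gt_zero by simp
qed

lemma laurent_unique:
  fixes c d :: "int \<Rightarrow> complex"
  assumes "\<And>z. norm z = 1 \<Longrightarrow> ((\<lambda>n. c n * z powi n) has_sum f z) UNIV"
    and "\<And>z. norm z = 1 \<Longrightarrow> ((\<lambda>n. d n * z powi n) has_sum f z) UNIV"
  shows "c = d"
proof
  fix m
  have "c m - d m = 0"
  proof (rule laurent_zero_unique)
    fix z :: complex assume z: "norm z = 1"
    have "((\<lambda>n. c n * z powi n + - (d n * z powi n)) has_sum f z + - f z) UNIV"
      using assms z by (intro has_sum_add) (auto simp: has_sum_uminus)
    then show "((\<lambda>n. (c n - d n) * z powi n) has_sum 0) UNIV"
      by (simp add: algebra_simps)
  qed
  then show "c m = d m" by simp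
qed

text \<open>The second factor is expanded in powers of \<open>1 / z\<close>, so the coefficients of
  the product are correlations \<open>a (m + d) * b m\<close> instead of convolutions. In this form
  the lemma serves twice: it expands the generating function, and with \<open>a = b\<close> it
  computes the inner products of the shifts.\<close>

lemma laurent_product:
  fixes a b :: "int \<Rightarrow> complex"
  assumes z: "z \<noteq> 0"
    and a: "((\<lambda>n. a n * z powi n) has_sum f) UNIV"
    and b: "((\<lambda>n. b n * z powi (- n)) has_sum g) UNIV"
  shows "((\<lambda>d. (\<Sum>\<^sub>\<infinity>m. a (m + d) * b m) * z powi d) has_sum f * g) UNIV"
    and "(\<lambda>m. a (m + d) * b m) summable_on UNIV"
proof -
  let ?h = "\<lambda>(n, m). (a n * z powi n) * (b m * z powi (- m))"
  have aa: "(\<lambda>n. norm (a n * z powi n)) summable_on UNIV"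
    and bb: "(\<lambda>n. norm (b n * z powi (- n))) summable_on UNIV"
    using a b by (auto simp flip: summable_on_iff_abs_summable_on_complex dest: has_sum_imp_summable)
  have sm: "?h summable_on UNIV \<times> UNIV"
  proof (rule Infinite_Sum.abs_summable_summable, subst Infinite_Sum.abs_summable_on_Sigma_iff, intro conjI ballI)
    show "(\<lambda>y. norm (?h (x, y))) summable_on UNIV" for x
      unfolding split norm_mult[of "a x * z powi x"] by (intro summable_on_cmult_right bb)
    have "(\<Sum>\<^sub>\<infinity>y. norm (?h (x, y))) = norm (a x * z powi x) * (\<Sum>\<^sub>\<infinity>y. norm (b y * z powi (- y)))" for x
      unfolding split norm_mult[of "a x * z powi x"] by (rule infsum_cmult_right')
    then have "(\<lambda>x. \<Sum>\<^sub>\<infinity>y. norm (?h (x, y))) summable_on UNIV"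
      using aa by (simp only: summable_on_cmult_left)
    then show "(\<lambda>x. norm (\<Sum>\<^sub>\<infinity>y. norm (?h (x, y)))) summable_on UNIV"
      by (rule iffD1[OF summable_on_iff_abs_summable_on_real])
  qed
  have hs: "(?h has_sum f * g) (UNIV \<times> UNIV)"
  proof (rule has_sum_SigmaI[OF _ _ sm])
    show "((\<lambda>y. ?h (x, y)) has_sum (a x * z powi x) * g) UNIV" for x
      unfolding split by (intro has_sum_cmult_right b)
    show "((\<lambda>x. a x * z powi x * g) has_sum f * g) UNIV"
      by (intro has_sum_cmult_left a)
  qed
  have bij: "(?h has_sum f * g) (UNIV \<times> UNIV) \<longleftrightarrow>
      ((\<lambda>(d, m). a (m + d) * b m * z powi d) has_sum f * g) (UNIV \<times> UNIV)"
    by (rule has_sum_reindex_bij_witness[of _ "\<lambda>(d, m). (m + d, m)" "\<lambda>(n, m). (n - m, m)"])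
      (use z in \<open>auto simp: power_int_diff power_int_minus divide_inverse\<close>)
  then have hs': "((\<lambda>(d, m). a (m + d) * b m * z powi d) has_sum f * g) (UNIV \<times> UNIV)"
    using hs by blast
  have s1: "(\<lambda>m. a (m + d) * b m * z powi d) summable_on UNIV" for d
    by (rule summable_on_SigmaD1[OF has_sum_imp_summable[OF hs']]) auto
  have s2: "(\<lambda>m. a (m + d) * b m) summable_on UNIV" for d
  proof -
    have "(\<lambda>m. a (m + d) * b m * z powi d * inverse (z powi d)) summable_on UNIV"
      by (intro summable_on_cmult_left s1)
    then show ?thesis using z by (simp add: mult.assoc)
  qed
  show "(\<lambda>m. a (m + d) * b m) summable_on UNIV" by (rule s2)
  show "((\<lambda>d. (\<Sum>\<^sub>\<infinity>m. a (m + d) * b m) * z powi d) has_sum f * g) UNIV"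
    by (rule has_sum_SigmaD[OF hs']) (auto intro!: has_sum_cmult_left has_sum_infsum s2)
qed

lemma has_sum_nat_to_int:
  fixes f :: "nat \<Rightarrow> 'a::{comm_monoid_add,topological_space}"
  assumes "(f has_sum s) UNIV"
  shows "((\<lambda>n::int. if n \<ge> 0 then f (nat n) else 0) has_sum s) UNIV"
proof -
  have "(f has_sum s) UNIV \<longleftrightarrow> ((\<lambda>n::int. if n \<ge> 0 then f (nat n) else 0) has_sum s) {0..}"
    by (rule has_sum_reindex_bij_witness[of _ nat int]) auto
  also have "\<dots> \<longleftrightarrow> ((\<lambda>n::int. if n \<ge> 0 then f (nat n) else 0) has_sum s) UNIV"
    by (rule has_sum_cong_neutral) auto
  finally show ?thesis using assms by simp
qed

subsection \<open>Euler's expansions of the q-Pochhammer symbol\<close>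

text \<open>The symbol \<open>(q; q)_n\<close>, the denominator in both of Euler's
  expansions.\<close>

definition qfactors :: "real \<Rightarrow> nat \<Rightarrow> real" where
  "qfactors q n = (\<Prod>k=1..n. 1 - q ^ k)"

lemma qfactors_0 [simp]: "qfactors q 0 = 1"
  and qfactors_Suc: "qfactors q (Suc n) = qfactors q n * (1 - q ^ Suc n)"
  by (simp_all add: qfactors_def)

lemma qpochhammer_inf_LIMSEQ:
  assumes "0 < q" "q < 1"
  shows "(\<lambda>n. \<Prod>k<n. 1 - a * of_real q ^ k) \<longlonglongrightarrow> qpochhammer_inf a q"
proof -
  have "summable (\<lambda>k. norm (a * of_real q ^ k))"
    using assms by (auto simp: norm_mult norm_power intro!: summable_mult summable_geometric)
  then have "summable (\<lambda>k. norm ((1 - a * of_real q ^ k) - 1))"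
    by simp
  then have "convergent_prod (\<lambda>k. 1 - a * of_real q ^ k)"
    by (intro abs_convergent_prod_imp_convergent_prod summable_imp_abs_convergent_prod)
  then have "(\<lambda>n. \<Prod>k\<le>n. 1 - a * of_real q ^ k) \<longlonglongrightarrow> qpochhammer_inf a q"
    unfolding qpochhammer_inf_def by (rule convergent_prod_LIMSEQ)
  then have "(\<lambda>n. \<Prod>k<Suc n. 1 - a * of_real q ^ k) \<longlonglongrightarrow> qpochhammer_inf a q"
    by (simp only: lessThan_Suc_atMost)
  then show ?thesis by (rule LIMSEQ_imp_Suc)
qed

lemma qpochhammer_inf_step:
  assumes "0 < q" "q < 1"
  shows "qpochhammer_inf a q = (1 - a) * qpochhammer_inf (of_real q * a) q"
proof -
  have "(\<lambda>n. (1 - a) * (\<Prod>k<n. 1 - (of_real q * a) * of_real q ^ k)) \<longlonglongrightarrow>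
      (1 - a) * qpochhammer_inf (of_real q * a) q"
    by (intro tendsto_intros qpochhammer_inf_LIMSEQ assms)
  also have "(\<lambda>n. (1 - a) * (\<Prod>k<n. 1 - (of_real q * a) * of_real q ^ k)) =
      (\<lambda>n. \<Prod>k<Suc n. 1 - a * of_real q ^ k)"
    by (simp only: prod.lessThan_Suc_shift) (simp add: mult_ac)
  finally show ?thesis
    using LIMSEQ_unique[OF LIMSEQ_Suc[OF qpochhammer_inf_LIMSEQ[OF assms, of a]]] by metis
qed

lemma summable_if_ratio_tendsto:
  fixes f :: "nat \<Rightarrow> 'a::banach"
  assumes "\<And>n. norm (f (Suc n)) = r n * norm (f n)" "r \<longlonglongrightarrow> l" "l < 1"
  shows "summable (\<lambda>n. norm (f n))"
proof -
  obtain c where c: "l < c" "c < 1" using assms(3) dense by blast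
  have "eventually (\<lambda>n. r n < c) sequentially"
    using assms(2) c(1) by (rule order_tendstoD)
  then obtain N where N: "\<And>n. n \<ge> N \<Longrightarrow> r n < c"
    by (auto simp: eventually_sequentially)
  show ?thesis
  proof (rule summable_ratio_test[OF c(2)])
    fix n assume "N \<le> n"
    then have "r n * norm (f n) \<le> c * norm (f n)"
      using N[of n] by (intro mult_right_mono) auto
    then show "norm (norm (f (Suc n))) \<le> c * norm (norm (f n))"
      using assms(1)[of n] norm_ge_zero[of "f (Suc n)"] by simp
  qed
qed

text \<open>Fixes the constant in the q-difference equations below: iterating them moves the
  argument \<open>w\<close> to \<open>q^k w\<close>, hence to 0, where a power series takes the
  value \<open>c 0\<close>.\<close>

lemma tendsto_q_shift:
  fixes c :: "nat \<Rightarrow> complex"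
  assumes q: "0 < q" "q < 1" and s: "summable (\<lambda>n. norm (c n * w ^ n))"
  shows "(\<lambda>k. \<Sum>n. c n * (of_real q ^ k * w) ^ n) \<longlonglongrightarrow> c 0"
proof (cases "w = 0")
  case True
  have "(\<Sum>n. c n * 0 ^ n) = c 0"
    using sums_unique[OF powser_sums_zero[of c]] by simp
  then show ?thesis using True by simp
next
  case False
  have "isCont (\<lambda>x. \<Sum>n. c n * x ^ n) 0"
    by (rule isCont_powser[OF summable_norm_cancel[OF s]]) (use False in simp)
  moreover have "(\<lambda>k. of_real q ^ k * w) \<longlonglongrightarrow> 0 * w"
    using q by (intro tendsto_intros LIMSEQ_power_zero) auto
  ultimately have "(\<lambda>k. \<Sum>n. c n * (of_real q ^ k * w) ^ n) \<longlonglongrightarrow> (\<Sum>n. c n * 0 ^ n)"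
    by (intro isCont_tendsto_compose[where g = "\<lambda>x. \<Sum>n. c n * x ^ n"]) auto
  also have "(\<Sum>n. c n * 0 ^ n) = c 0"
    using sums_unique[OF powser_sums_zero[of c]] by simp
  finally show ?thesis .
qed

lemma power_tendsto_0: "0 < q \<Longrightarrow> q < 1 \<Longrightarrow> (\<lambda>n. (q::real) ^ Suc n) \<longlonglongrightarrow> 0"
  by (intro LIMSEQ_Suc LIMSEQ_power_zero) auto

lemma one_minus_q_power_pos: "0 < q \<Longrightarrow> q < 1 \<Longrightarrow> 0 < 1 - (q::real) ^ Suc n"
  using power_less_one_iff[of q "Suc n"] by simp

lemma qfactors_pos: "0 < q \<Longrightarrow> q < 1 \<Longrightarrow> 0 < qfactors q n"
  by (induction n) (auto simp: qfactors_Suc simp del: power_Suc intro!: mult_pos_pos one_minus_q_power_pos)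

text \<open>The series \<open>e\<close> satisfies \<open>e (q v) = (1 - v) e v\<close>. Iterating
  this pulls out the partial products, and letting the argument tend to 0 gives
  \<open>qpochhammer_inf w q * e w = 1\<close>. In particular the product is nonzero.\<close>

lemma euler_inverse:
  fixes w :: complex
  assumes q: "0 < q" "q < 1" and w: "norm w < 1"
  shows "((\<lambda>n. of_real (1 / qfactors q n) * w ^ n) has_sum 1 / qpochhammer_inf w q) UNIV"
    and "qpochhammer_inf w q \<noteq> 0"
proof -
  define c where "c = (\<lambda>n. complex_of_real (1 / qfactors q n))"
  note pos = qfactors_pos[OF q] one_minus_q_power_pos[OF q]
  have cS: "c (Suc n) * of_real (1 - q ^ Suc n) = c n" for n
    using pos(1)[of n] pos(2)[of n] by (simp add: c_def qfactors_Suc field_simps del: power_Suc flip: of_real_mult of_real_diff)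
  have sm: "summable (\<lambda>n. norm (c n * v ^ n))" if v: "norm v < 1" for v
  proof (rule summable_if_ratio_tendsto)
    show "norm (c (Suc n) * v ^ Suc n) = norm v / (1 - q ^ Suc n) * norm (c n * v ^ n)" for n
      using pos(2)[of n]
      by (simp add: cS[of n, symmetric] norm_mult norm_power del: power_Suc of_real_diff) (simp add: field_simps)
    show "(\<lambda>n. norm v / (1 - q ^ Suc n)) \<longlonglongrightarrow> norm v / (1 - 0)"
      by (intro tendsto_intros power_tendsto_0 q) auto
  qed (use v in simp)
  define e where "e = (\<lambda>v. \<Sum>n. c n * v ^ n)"
  have step: "e (of_real q * v) = (1 - v) * e v" if v: "norm v < 1" for v
  proof -
    have "norm (of_real q * v) \<le> norm v"
      using q by (simp add: norm_mult mult_left_le_one_le)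
    then have v': "norm (of_real q * v) < 1" using v by linarith
    note S = summable_norm_cancel[OF sm[OF v]] summable_norm_cancel[OF sm[OF v']]
    have "e v - e (of_real q * v) = (\<Sum>n. c n * v ^ n - c n * (of_real q * v) ^ n)"
      unfolding e_def by (rule suminf_diff[OF S])
    also have "\<dots> = (\<Sum>n. c (Suc n) * v ^ Suc n - c (Suc n) * (of_real q * v) ^ Suc n)"
      by (subst suminf_split_head[OF summable_diff[OF S]]) simp
    also have "\<dots> = (\<Sum>n. v * (c n * v ^ n))"
    proof (intro suminf_cong)
      fix n
      have "c (Suc n) * v ^ Suc n - c (Suc n) * (of_real q * v) ^ Suc n =
          (c (Suc n) * of_real (1 - q ^ Suc n)) * v ^ Suc n"
        by (simp add: power_mult_distrib algebra_simps)
      then show "c (Suc n) * v ^ Suc n - c (Suc n) * (of_real q * v) ^ Suc n = v * (c n * v ^ n)"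
        unfolding cS by simp
    qed
    also have "\<dots> = v * e v"
      unfolding e_def by (rule suminf_mult[OF S(1)])
    finally show ?thesis by (simp add: algebra_simps)
  qed
  have iter: "e (of_real q ^ k * w) = (\<Prod>j<k. 1 - w * of_real q ^ j) * e w" for k
  proof (induction k)
    case (Suc k)
    have "norm (of_real q ^ k * w) \<le> norm w"
      using q by (simp add: norm_mult norm_power mult_left_le_one_le power_le_one)
    then have "e (of_real q * (of_real q ^ k * w)) = (1 - of_real q ^ k * w) * e (of_real q ^ k * w)"
      using w by (intro step) linarith
    then show ?case using Suc by (simp add: mult_ac)
  qed simp
  have "(\<lambda>k. e (of_real q ^ k * w)) \<longlonglongrightarrow> c 0"
    unfolding e_def by (rule tendsto_q_shift[OF q sm[OF w]])
  moreover have "(\<lambda>k. e (of_real q ^ k * w)) \<longlonglongrightarrow> qpochhammer_inf w q * e w"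
    unfolding iter by (intro tendsto_intros qpochhammer_inf_LIMSEQ q)
  ultimately have "qpochhammer_inf w q * e w = c 0"
    using LIMSEQ_unique by blast
  then have *: "qpochhammer_inf w q * e w = 1"
    by (simp add: c_def)
  then have "e w = 1 / qpochhammer_inf w q"
    by (metis mult_zero_left nonzero_mult_div_cancel_left zero_neq_one)
  moreover have "((\<lambda>n. c n * w ^ n) has_sum e w) UNIV"
    unfolding e_def by (rule norm_summable_imp_has_sum[OF sm[OF w] summable_sums[OF summable_norm_cancel[OF sm[OF w]]]])
  ultimately show "((\<lambda>n. of_real (1 / qfactors q n) * w ^ n) has_sum 1 / qpochhammer_inf w q) UNIV"
    by (simp add: c_def)
  show "qpochhammer_inf w q \<noteq> 0" using * by auto
qed

text \<open>Here the equation is \<open>e v = (1 - v) e (q v)\<close>; the coefficient ratio tends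
  to 0, so there is no restriction on \<open>w\<close>. The product of \<open>q ^ k\<close> over
  \<open>k < n\<close> is \<open>q^(n(n-1)/2)\<close>.\<close>

lemma euler_product:
  fixes w :: complex
  assumes q: "0 < q" "q < 1"
  shows "((\<lambda>n. of_real ((- 1) ^ n * (\<Prod>k<n. q ^ k) / qfactors q n) * w ^ n) has_sum
    qpochhammer_inf w q) UNIV"
proof -
  define c where "c = (\<lambda>n. complex_of_real ((- 1) ^ n * (\<Prod>k<n. q ^ k) / qfactors q n))"
  note pos = qfactors_pos[OF q] one_minus_q_power_pos[OF q]
  have cS': "c (Suc n) = of_real (- (q ^ n / (1 - q ^ Suc n))) * c n" for n
  proof -
    have "(- 1 * E) * (P * Q) / (F * X) = - (Q / X) * (E * P / F)" for E P Q F X :: real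
      by (simp add: mult_ac)
    then show ?thesis
      unfolding c_def of_real_mult[symmetric] of_real_eq_iff
        qfactors_Suc power_Suc[of "- 1"] prod.lessThan_Suc .
  qed
  have cS: "c (Suc n) * of_real (1 - q ^ Suc n) = - of_real (q ^ n) * c n" for n
  proof -
    have "- (q ^ n / (1 - q ^ Suc n)) * (1 - q ^ Suc n) = - (q ^ n)"
      using pos(2)[of n] by simp
    moreover have "c (Suc n) * of_real (1 - q ^ Suc n) =
        of_real (- (q ^ n / (1 - q ^ Suc n)) * (1 - q ^ Suc n)) * c n"
      unfolding cS' of_real_mult by (simp only: mult_ac)
    ultimately show ?thesis by simp
  qed
  have sm: "summable (\<lambda>n. norm (c n * v ^ n))" for v
  proof (rule summable_if_ratio_tendsto)
    show "norm (c (Suc n) * v ^ Suc n) = q ^ n / (1 - q ^ Suc n) * norm v * norm (c n * v ^ n)" for n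
      using pos(2)[of n] q
      by (simp only: cS' norm_mult norm_of_real norm_power) simp
    show "(\<lambda>n. q ^ n / (1 - q ^ Suc n) * norm v) \<longlonglongrightarrow> 0 / (1 - 0) * norm v"
      using q by (intro tendsto_intros power_tendsto_0 q LIMSEQ_power_zero) auto
  qed simp
  define e where "e = (\<lambda>v. \<Sum>n. c n * v ^ n)"
  have step: "e v = (1 - v) * e (of_real q * v)" for v
  proof -
    note S = summable_norm_cancel[OF sm[of v]] summable_norm_cancel[OF sm[of "of_real q * v"]]
    have "e v - e (of_real q * v) = (\<Sum>n. c n * v ^ n - c n * (of_real q * v) ^ n)"
      unfolding e_def by (rule suminf_diff[OF S])
    also have "\<dots> = (\<Sum>n. c (Suc n) * v ^ Suc n - c (Suc n) * (of_real q * v) ^ Suc n)"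
      by (subst suminf_split_head[OF summable_diff[OF S]]) simp
    also have "\<dots> = (\<Sum>n. - v * (c n * (of_real q * v) ^ n))"
    proof (intro suminf_cong)
      fix n
      have "c (Suc n) * v ^ Suc n - c (Suc n) * (of_real q * v) ^ Suc n =
          (c (Suc n) * of_real (1 - q ^ Suc n)) * v ^ Suc n"
        by (simp add: power_mult_distrib algebra_simps)
      then show "c (Suc n) * v ^ Suc n - c (Suc n) * (of_real q * v) ^ Suc n =
          - v * (c n * (of_real q * v) ^ n)"
        unfolding cS by (simp add: power_mult_distrib)
    qed
    also have "\<dots> = - v * e (of_real q * v)"
      unfolding e_def by (rule suminf_mult[OF S(2)])
    finally show ?thesis by (simp add: algebra_simps)
  qed
  have iter: "e w = (\<Prod>j<k. 1 - w * of_real q ^ j) * e (of_real q ^ k * w)" for k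
  proof (induction k)
    case (Suc k)
    then show ?case using step[of "of_real q ^ k * w"] by (simp add: mult_ac)
  qed simp
  have "(\<lambda>k. e (of_real q ^ k * w)) \<longlonglongrightarrow> c 0"
    unfolding e_def by (rule tendsto_q_shift[OF q sm])
  then have "(\<lambda>k. (\<Prod>j<k. 1 - w * of_real q ^ j) * e (of_real q ^ k * w)) \<longlonglongrightarrow> qpochhammer_inf w q * c 0"
    by (intro tendsto_intros qpochhammer_inf_LIMSEQ q)
  then have "(\<lambda>k::nat. e w) \<longlonglongrightarrow> qpochhammer_inf w q * c 0"
    unfolding iter[symmetric] .
  then have "e w = qpochhammer_inf w q * c 0"
    by (intro LIMSEQ_unique[OF tendsto_const])
  then have "e w = qpochhammer_inf w q"
    by (simp add: c_def)
  moreover have "((\<lambda>n. c n * w ^ n) has_sum e w) UNIV"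
    unfolding e_def by (rule norm_summable_imp_has_sum[OF sm summable_sums[OF summable_norm_cancel[OF sm]]])
  ultimately show ?thesis by (simp add: c_def)
qed

subsection \<open>Hahn--Exton Bessel functions\<close>

definition hahn_exton_gen :: "real \<Rightarrow> real \<Rightarrow> complex \<Rightarrow> complex" where
  "hahn_exton_gen q \<xi> z =
    qpochhammer_inf (of_real q * of_real \<xi> / z) q / qpochhammer_inf (of_real \<xi> * z) q"

text \<open>Product of the two Euler expansions, one in powers of \<open>z\<close> and one in powers
  of \<open>1 / z\<close>. All their coefficients are real, hence so are the correlation sums; these
  do not depend on \<open>z\<close>, so one \<open>J\<close> serves the whole punctured
  disc.\<close>

lemma real_laurent_expansion_exists:
  assumes q: "0 < q" "q < 1"
  shows "\<exists>J :: int \<Rightarrow> real. \<forall>z. z \<noteq> 0 \<and> norm (of_real \<xi> * z) < 1 \<longrightarrow>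
    ((\<lambda>n. of_real (J n) * z powi n) has_sum hahn_exton_gen q \<xi> z) UNIV"
proof -
  define a where "a = (\<lambda>n::int. if n \<ge> 0 then \<xi> ^ nat n / qfactors q (nat n) else 0)"
  define b where "b = (\<lambda>n::int. if n \<ge> 0
    then (- 1) ^ nat n * (\<Prod>k<nat n. q ^ k) / qfactors q (nat n) * (q * \<xi>) ^ nat n else 0)"
  define S where "S = (\<lambda>d. \<Sum>\<^sub>\<infinity>m. complex_of_real (a (m + d)) * complex_of_real (b m))"
  have main: "((\<lambda>d. S d * z powi d) has_sum hahn_exton_gen q \<xi> z) UNIV"
    "(\<lambda>m. complex_of_real (a (m + d)) * complex_of_real (b m)) summable_on UNIV"
    if z: "z \<noteq> 0" "norm (of_real \<xi> * z) < 1" for z d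
  proof -
    have 1: "((\<lambda>n. complex_of_real (a n) * z powi n) has_sum 1 / qpochhammer_inf (of_real \<xi> * z) q) UNIV"
    proof (rule has_sum_cong[THEN iffD1, OF _ has_sum_nat_to_int[OF euler_inverse(1)[OF q z(2)]]])
      fix n :: int
      show "(if 0 \<le> n then complex_of_real (1 / qfactors q (nat n)) * (of_real \<xi> * z) ^ nat n else 0)
          = complex_of_real (a n) * z powi n"
        by (auto simp: a_def power_int_def power_mult_distrib)
    qed
    have 2: "((\<lambda>n. complex_of_real (b n) * z powi (- n)) has_sum
        qpochhammer_inf (of_real q * of_real \<xi> / z) q) UNIV"
    proof (rule has_sum_cong[THEN iffD1, OF _ has_sum_nat_to_int[OF euler_product[OF q]]])
      fix n :: int
      show "(if 0 \<le> n then complex_of_real ((- 1) ^ nat n * (\<Prod>k<nat n. q ^ k) / qfactors q (nat n)) *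
          (of_real q * of_real \<xi> / z) ^ nat n else 0) = complex_of_real (b n) * z powi - n"
        by (auto simp: b_def power_int_def power_mult_distrib power_divide divide_inverse power_inverse)
    qed
    show "((\<lambda>d. S d * z powi d) has_sum hahn_exton_gen q \<xi> z) UNIV"
      using laurent_product(1)[OF z(1) 1 2] by (simp add: S_def hahn_exton_gen_def)
    show "(\<lambda>m. complex_of_real (a (m + d)) * complex_of_real (b m)) summable_on UNIV"
      by (rule laurent_product(2)[OF z(1) 1 2])
  qed
  \<comment> \<open>Summability of the correlation sums does not mention \<open>z\<close>, but it is
    deduced from convergence at a point, so an admissible point has to be exhibited. This one works
    for every real \<xi>.\<close>
  obtain z0 :: complex where z0: "z0 \<noteq> 0" "norm (of_real \<xi> * z0) < 1"
  proof (rule that[of "of_real (1 / (1 + \<bar>\<xi>\<bar>))"])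
    show "complex_of_real (1 / (1 + \<bar>\<xi>\<bar>)) \<noteq> 0"
      unfolding of_real_eq_0_iff by simp
    show "norm (of_real \<xi> * complex_of_real (1 / (1 + \<bar>\<xi>\<bar>))) < 1"
      by (simp only: norm_mult norm_of_real) simp
  qed
  have S: "complex_of_real (Re (S d)) = S d" for d
  proof -
    have "((\<lambda>m. Im (complex_of_real (a (m + d)) * complex_of_real (b m))) has_sum Im (S d)) UNIV"
      unfolding S_def by (intro has_sum_Im has_sum_infsum main(2)[OF z0])
    then have "Im (S d) = 0"
      by (intro has_sum_unique[OF _ has_sum_0_simp]) auto
    then show ?thesis by (simp add: complex_eq_iff)
  qed
  show ?thesis
    by (rule exI[of _ "\<lambda>d. Re (S d)"], unfold S) (use main(1) in blast)
qed

text \<open>The description in \<open>hahn_exton_J\<close> singles out one sequence: uniqueness is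
  decided on the unit circle, and \<open>\<xi> < 1\<close> puts that circle inside the domain of the
  expansion.\<close>

lemma hahn_exton_J_has_sum:
  assumes q: "0 < q" "q < 1" and \<xi>: "0 < \<xi>" "\<xi> < 1"
    and z: "z \<noteq> 0" "norm (of_real \<xi> * z) < 1"
  shows "((\<lambda>n. of_real (hahn_exton_J q (2 * \<xi>) n) * z powi n) has_sum hahn_exton_gen q \<xi> z) UNIV"
proof -
  define P where "P = (\<lambda>J :: int \<Rightarrow> real. \<forall>z. z \<noteq> 0 \<and> norm (of_real \<xi> * z) < 1 \<longrightarrow>
    ((\<lambda>n. of_real (J n) * z powi n) has_sum hahn_exton_gen q \<xi> z) UNIV)"
  have "(\<forall>z. z \<noteq> 0 \<and> norm (of_real (2 * \<xi>) * z / 2) < 1 \<longrightarrow>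
     ((\<lambda>n. z powi n * of_real (J n)) has_sum
       qpochhammer_inf (of_real q * of_real (2 * \<xi>) / (2 * z)) q /
       qpochhammer_inf (of_real (2 * \<xi>) * z / 2) q) UNIV) = P J" for J
    by (simp add: P_def hahn_exton_gen_def mult_ac)
  then have J: "hahn_exton_J q (2 * \<xi>) = (THE J. P J)"
    unfolding hahn_exton_J_def by presburger
  have "\<exists>!J. P J"
  proof (rule ex_ex1I)
    show "\<exists>J. P J" unfolding P_def by (rule real_laurent_expansion_exists[OF q])
    fix J J' assume *: "P J" "P J'"
    have "(\<lambda>n. complex_of_real (J n)) = (\<lambda>n. complex_of_real (J' n))"
    proof (rule laurent_unique)
      fix z :: complex assume "norm z = 1"
      then have "z \<noteq> 0 \<and> norm (of_real \<xi> * z) < 1"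
        using \<xi> by (auto simp: norm_mult)
      then show "((\<lambda>n. complex_of_real (J n) * z powi n) has_sum hahn_exton_gen q \<xi> z) UNIV"
        "((\<lambda>n. complex_of_real (J' n) * z powi n) has_sum hahn_exton_gen q \<xi> z) UNIV"
        using * by (simp_all add: P_def)
    qed
    then show "J = J'" by (simp add: fun_eq_iff)
  qed
  then have "P (hahn_exton_J q (2 * \<xi>))"
    unfolding J by (rule theI')
  then show ?thesis using z by (simp add: P_def)
qed

text \<open>Replacing \<open>z\<close> by \<open>q z\<close> adds one factor to the numerator
  product and removes one from the denominator. On the unit circle the resulting multiplier is the
  squared modulus of \<open>1 - \<xi> z\<close>, the symbol of \<open>A\<close>.\<close>

lemma hahn_exton_gen_shift:
  assumes q: "0 < q" "q < 1" and \<xi>: "0 < \<xi>" "\<xi> < 1" and z: "norm z = 1"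
  shows "hahn_exton_gen q \<xi> (of_real q * z) =
    (1 - of_real \<xi> / z) * (1 - of_real \<xi> * z) * hahn_exton_gen q \<xi> z"
proof -
  have z0: "z \<noteq> 0" using z by auto
  have "qpochhammer_inf (of_real \<xi> / z) q = (1 - of_real \<xi> / z) * qpochhammer_inf (of_real q * (of_real \<xi> / z)) q"
    and 2: "qpochhammer_inf (of_real \<xi> * z) q = (1 - of_real \<xi> * z) * qpochhammer_inf (of_real q * (of_real \<xi> * z)) q"
    by (rule qpochhammer_inf_step[OF q])+
  moreover have "1 - of_real \<xi> * z \<noteq> 0"
  proof
    assume "1 - of_real \<xi> * z = 0"
    then have "norm (of_real \<xi> * z) = 1" by (metis eq_iff_diff_eq_0 norm_one)
    then show False using z \<xi> by (simp add: norm_mult)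
  qed
  ultimately show ?thesis
    using q z0 by (simp add: hahn_exton_gen_def mult_ac)
qed

text \<open>Rescales the circle of radius \<open>t\<close> to the unit circle, moving
  \<open>t powi n\<close> into the coefficients. It is applied with \<open>t = 1\<close>,
  \<open>t = q\<close> and \<open>t = sqrt q\<close>.\<close>

lemma hahn_exton_J_circle:
  assumes q: "0 < q" "q < 1" and \<xi>: "0 < \<xi>" "\<xi> < 1"
    and t: "0 < t" "t \<le> 1" and z: "norm z = 1"
  shows "((\<lambda>n. of_real (t powi n * hahn_exton_J q (2 * \<xi>) n) * z powi n) has_sum
    hahn_exton_gen q \<xi> (of_real t * z)) UNIV"
proof -
  have "\<xi> * t < 1"
    using \<xi> t by (intro order.strict_trans1[OF mult_right_le_one_le[of \<xi> t]]) auto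
  then have n: "norm (of_real \<xi> * (of_real t * z)) < 1"
    using \<xi> t z by (simp add: norm_mult)
  have "of_real t * z \<noteq> 0" using t z by auto
  from hahn_exton_J_has_sum[OF q \<xi> this n] show ?thesis
    by (simp add: power_int_mult_distrib mult_ac)
qed

lemma has_sum_shift_int:
  fixes f :: "int \<Rightarrow> 'a::{comm_monoid_add,topological_space}"
  shows "((\<lambda>n. f (n + d)) has_sum s) UNIV \<longleftrightarrow> (f has_sum s) UNIV"
  by (rule has_sum_reindex_bij_witness[of _ "\<lambda>n. n - d" "\<lambda>n. n + d"]) auto

text \<open>Comparison of coefficients in \<open>hahn_exton_gen_shift\<close>. For \<open>J\<close>
  itself the relation between \<open>A\<close> and multiplication by \<open>q powi n\<close> is
  exact, but the shifts of \<open>J\<close> are not orthonormal.\<close>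

lemma hahn_exton_J_recurrence:
  assumes q: "0 < q" "q < 1" and \<xi>: "0 < \<xi>" "\<xi> < 1"
  defines "J \<equiv> hahn_exton_J q (2 * \<xi>)"
  shows "q powi n * J n = (1 + \<xi>\<^sup>2) * J n - \<xi> * (J (n + 1) + J (n - 1))"
proof -
  have "(\<lambda>n. complex_of_real (q powi n * J n)) =
      (\<lambda>n. complex_of_real ((1 + \<xi>\<^sup>2) * J n - \<xi> * (J (n + 1) + J (n - 1))))"
  proof (rule laurent_unique)
    fix z :: complex assume z: "norm z = 1"
    then have z0: "z \<noteq> 0" by auto
    let ?F = "hahn_exton_gen q \<xi> z"
    show "((\<lambda>n. complex_of_real (q powi n * J n) * z powi n) has_sum
        hahn_exton_gen q \<xi> (of_real q * z)) UNIV"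
      unfolding J_def by (rule hahn_exton_J_circle) (use q \<xi> z in auto)
    have F: "((\<lambda>n. of_real (J n) * z powi n) has_sum ?F) UNIV"
      using hahn_exton_J_circle[OF q \<xi>, of 1 z] z by (simp add: J_def)
    have F1: "((\<lambda>n. of_real (J (n + 1)) * z powi n) has_sum inverse z * ?F) UNIV"
    proof -
      have shifted: "((\<lambda>n. of_real (J (n + 1)) * z powi (n + 1)) has_sum ?F) UNIV"
        using F has_sum_shift_int[of "\<lambda>n. of_real (J n) * z powi n" 1 ?F] by blast
      moreover have "inverse z * (y * z powi (n + 1)) = y * z powi n" for y n
        using z0 by (simp add: power_int_add)
      ultimately show ?thesis
        using has_sum_cmult_right[OF shifted, of "inverse z"] by (simp only:)
    qed
    have F2: "((\<lambda>n. of_real (J (n - 1)) * z powi n) has_sum z * ?F) UNIV"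
    proof -
      have shifted: "((\<lambda>n. of_real (J (n - 1)) * z powi (n - 1)) has_sum ?F) UNIV"
        using F has_sum_shift_int[of "\<lambda>n. of_real (J n) * z powi n" "- 1" ?F] by simp
      moreover have "z * (y * z powi (n - 1)) = y * z powi n" for y n
        using z0 by (simp add: power_int_diff)
      ultimately show ?thesis
        using has_sum_cmult_right[OF shifted, of z] by (simp only:)
    qed
    have "((\<lambda>n. of_real (1 + \<xi>\<^sup>2) * (of_real (J n) * z powi n) +
        of_real (- \<xi>) * (of_real (J (n + 1)) * z powi n + of_real (J (n - 1)) * z powi n)) has_sum
        (of_real (1 + \<xi>\<^sup>2) * ?F + of_real (- \<xi>) * (inverse z * ?F + z * ?F))) UNIV"
      by (intro has_sum_add has_sum_cmult_right F F1 F2)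
    also have "of_real (1 + \<xi>\<^sup>2) * ?F + of_real (- \<xi>) * (inverse z * ?F + z * ?F) =
        hahn_exton_gen q \<xi> (of_real q * z)"
      unfolding hahn_exton_gen_shift[OF q \<xi> z] using z0
      by (simp add: field_simps power2_eq_square)
    also have "(\<lambda>n. of_real (1 + \<xi>\<^sup>2) * (of_real (J n) * z powi n) +
        of_real (- \<xi>) * (of_real (J (n + 1)) * z powi n + of_real (J (n - 1)) * z powi n)) =
        (\<lambda>n. complex_of_real ((1 + \<xi>\<^sup>2) * J n - \<xi> * (J (n + 1) + J (n - 1))) * z powi n)"
      by (simp add: algebra_simps)
    finally show "((\<lambda>n. complex_of_real ((1 + \<xi>\<^sup>2) * J n - \<xi> * (J (n + 1) + J (n - 1))) * z powi n)
        has_sum hahn_exton_gen q \<xi> (of_real q * z)) UNIV" .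
  qed
  then show ?thesis using of_real_eq_iff by metis
qed

section \<open>Orthonormal coefficients and the kernel as a Gram matrix\<close>

definition qbessel_coeff :: "real \<Rightarrow> real \<Rightarrow> int \<Rightarrow> real" where
  "qbessel_coeff q \<xi> n = sqrt q powi n * hahn_exton_J q (2 * \<xi>) n"

text \<open>The weight \<open>sqrt q powi n\<close> buys orthonormality and spoils the exact
  relation: the two neighbours acquire the factors \<open>1 / sqrt q\<close> and
  \<open>sqrt q\<close>, which tend to 1 as \<open>q\<close> does.\<close>

lemma qbessel_coeff_recurrence:
  assumes q: "0 < q" "q < 1" and \<xi>: "0 < \<xi>" "\<xi> < 1"
  defines "c \<equiv> qbessel_coeff q \<xi>"
  shows "q powi n * c n = (1 + \<xi>\<^sup>2) * c n - \<xi> * (c (n + 1) / sqrt q + sqrt q * c (n - 1))"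
proof -
  have s: "sqrt q \<noteq> 0" using q by simp
  have "sqrt q powi n * (q powi n * hahn_exton_J q (2 * \<xi>) n) =
      sqrt q powi n * ((1 + \<xi>\<^sup>2) * hahn_exton_J q (2 * \<xi>) n -
        \<xi> * (hahn_exton_J q (2 * \<xi>) (n + 1) + hahn_exton_J q (2 * \<xi>) (n - 1)))"
    using hahn_exton_J_recurrence[OF q \<xi>] by simp
  then show ?thesis
    using s by (simp add: c_def qbessel_coeff_def power_int_add power_int_diff algebra_simps)
qed

text \<open>With \<open>t = sqrt q\<close> the map \<open>z -> q / z\<close> preserves the circle of
  radius \<open>t\<close>, and the numerator of the generating function at \<open>t z\<close> is its
  denominator at \<open>t / z\<close>, and vice versa. The two values multiply to 1, and comparing
  coefficients in this identity gives all the inner products.\<close>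

lemma qbessel_coeff_orthonormal:
  assumes q: "0 < q" "q < 1" and \<xi>: "0 < \<xi>" "\<xi> < 1"
  defines "c \<equiv> qbessel_coeff q \<xi>"
  shows "((\<lambda>m. c (m + d) * c m) has_sum (if d = 0 then 1 else 0)) UNIV"
proof -
  define t where "t = sqrt q"
  have t: "0 < t" "t \<le> 1" using q by (auto simp: t_def)
  have tc: "complex_of_real (c n) = of_real (t powi n * hahn_exton_J q (2 * \<xi>) n)" for n
    by (simp add: c_def qbessel_coeff_def t_def)
  have ser: "((\<lambda>n. of_real (c n) * z powi n) has_sum hahn_exton_gen q \<xi> (of_real t * z)) UNIV"
    if "norm z = 1" for z
    unfolding tc by (rule hahn_exton_J_circle[OF q \<xi> t that])
  have ser': "((\<lambda>n. of_real (c n) * z powi (- n)) has_sum hahn_exton_gen q \<xi> (of_real t / z)) UNIV"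
    if "norm z = 1" for z
    using ser[of "inverse z"] that by (simp add: norm_inverse power_int_minus power_int_inverse divide_inverse)
  have one: "hahn_exton_gen q \<xi> (of_real t * z) * hahn_exton_gen q \<xi> (of_real t / z) = 1"
    if z: "norm z = 1" for z
  proof -
    have z0: "z \<noteq> 0" using z by auto
    have "\<xi> * t < 1"
      using \<xi> t by (intro order.strict_trans1[OF mult_right_le_one_le[of \<xi> t]]) auto
    then have "norm (of_real \<xi> * (of_real t * z)) < 1" "norm (of_real \<xi> * (of_real t / z)) < 1"
      using \<xi> t z by (simp_all add: norm_mult norm_divide)
    then have "qpochhammer_inf (of_real \<xi> * (of_real t * z)) q \<noteq> 0"
      "qpochhammer_inf (of_real \<xi> * (of_real t / z)) q \<noteq> 0"
      by (auto dest: euler_inverse(2)[OF q])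
    moreover have "of_real q * of_real \<xi> / (of_real t * z) = of_real \<xi> * (of_real t / z)"
      "of_real q * of_real \<xi> / (of_real t / z) = of_real \<xi> * (of_real t * z)"
      using q z0 t by (auto simp: field_simps t_def simp flip: of_real_mult)
    ultimately show ?thesis by (simp add: hahn_exton_gen_def)
  qed
  note prod = laurent_product[where a = "\<lambda>n. complex_of_real (c n)" and b = "\<lambda>n. complex_of_real (c n)", OF _ ser ser']
  have "(\<lambda>d. \<Sum>\<^sub>\<infinity>m. complex_of_real (c (m + d)) * of_real (c m)) = (\<lambda>d. if d = 0 then 1 else 0)"
  proof (rule laurent_unique)
    fix z :: complex assume z: "norm z = 1"
    then have z0: "z \<noteq> 0" by auto
    show "((\<lambda>n. (\<Sum>\<^sub>\<infinity>m. complex_of_real (c (m + n)) * of_real (c m)) * z powi n) has_sum 1) UNIV"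
      using prod(1)[OF z0 z z] by (simp add: one[OF z])
    have "((\<lambda>n. (if n = 0 then 1 else 0) * z powi n) has_sum 1) {0}"
      by (rule has_sum_finiteI) auto
    also have "?this \<longleftrightarrow> ((\<lambda>n. (if n = 0 then 1 else 0) * z powi n) has_sum 1) UNIV"
      by (rule has_sum_cong_neutral) auto
    finally show "((\<lambda>n. (if n = 0 then 1 else 0) * z powi n) has_sum 1) UNIV" .
  qed
  then have "(\<Sum>\<^sub>\<infinity>m. complex_of_real (c (m + d)) * of_real (c m)) = (if d = 0 then 1 else 0)"
    by meson
  then have "((\<lambda>m. complex_of_real (c (m + d)) * of_real (c m)) has_sum (if d = 0 then 1 else 0)) UNIV"
    using has_sum_infsum[OF prod(2)[of 1 d]] by simp
  from has_sum_Re[OF this] show ?thesis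
    by (simp add: if_distrib cong: if_cong)
qed

lemma hahn_exton_J_LIMSEQ:
  assumes q: "0 < q" "q < 1" and \<xi>: "0 < \<xi>" "\<xi> < 1"
  shows "(\<lambda>k. hahn_exton_J q (2 * \<xi>) (n + int k)) \<longlonglongrightarrow> 0"
proof -
  have "(\<lambda>n. complex_of_real (hahn_exton_J q (2 * \<xi>) n)) summable_on UNIV"
    using hahn_exton_J_circle[OF q \<xi>, of 1 1] by (auto dest: has_sum_imp_summable)
  then have "(\<lambda>n. complex_of_real (hahn_exton_J q (2 * \<xi>) n)) summable_on {n..}"
    by (rule summable_on_subset_banach) auto
  also have "?this \<longleftrightarrow> (\<lambda>k. complex_of_real (hahn_exton_J q (2 * \<xi>) (n + int k))) summable_on UNIV"
    by (rule summable_on_reindex_bij_witness[of _ "\<lambda>k. n + int k" "\<lambda>m. nat (m - n)"]) auto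
  finally have "summable (\<lambda>k. complex_of_real (hahn_exton_J q (2 * \<xi>) (n + int k)))"
    by (rule summable_on_imp_summable)
  then have "(\<lambda>k. complex_of_real (hahn_exton_J q (2 * \<xi>) (n + int k))) \<longlonglongrightarrow> of_real 0"
    using summable_LIMSEQ_zero by fastforce
  then show ?thesis by (simp only: tendsto_of_real_iff)
qed

text \<open>\<open>W\<close> is the discrete Wronskian of two translates of \<open>J\<close>. By the
  three-term recurrence its increments are products of values of \<open>J\<close> times the
  difference of the two weights \<open>q powi n\<close>, and it vanishes at infinity, so the
  increments sum to \<open>- W 0\<close>.\<close>

lemma hahn_exton_christoffel_darboux:
  assumes q: "0 < q" "q < 1" and \<xi>: "0 < \<xi>" "\<xi> < 1"
  defines "J \<equiv> hahn_exton_J q (2 * \<xi>)"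
  shows "(\<lambda>k. (q powi (M + int k + 1) - q powi (L + int k + 1)) * (J (M + int k + 1) * J (L + int k + 1))) sums
    (\<xi> * (J (M + 1) * J L - J M * J (L + 1)))"
proof -
  define W where "W = (\<lambda>k. \<xi> * (J (M + int k) * J (L + int k + 1) - J (M + int k + 1) * J (L + int k)))"
  have rec: "\<xi> * (J (n + 1) + J (n - 1)) = (1 + \<xi>\<^sup>2 - q powi n) * J n" for n
    using hahn_exton_J_recurrence[OF q \<xi>, of n] by (simp add: J_def algebra_simps)
  have step: "W (Suc k) - W k =
      (q powi (M + int k + 1) - q powi (L + int k + 1)) * (J (M + int k + 1) * J (L + int k + 1))" for k
  proof -
    have "W (Suc k) - W k = J (M + int k + 1) * (\<xi> * (J (L + int k + 1 + 1) + J (L + int k + 1 - 1)))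
        - J (L + int k + 1) * (\<xi> * (J (M + int k + 1 + 1) + J (M + int k + 1 - 1)))"
      by (simp add: W_def algebra_simps)
    then show ?thesis unfolding rec by (simp add: algebra_simps)
  qed
  have "W \<longlonglongrightarrow> \<xi> * (0 * 0 - 0 * 0)"
    unfolding W_def J_def using hahn_exton_J_LIMSEQ[OF q \<xi>, of M] hahn_exton_J_LIMSEQ[OF q \<xi>, of L]
      hahn_exton_J_LIMSEQ[OF q \<xi>, of "M + 1"] hahn_exton_J_LIMSEQ[OF q \<xi>, of "L + 1"]
    by (intro tendsto_intros) (simp_all add: add_ac)
  then have "(\<lambda>k. W (Suc k) - W k) sums (\<xi> * (0 * 0 - 0 * 0) - W 0)"
    by (rule telescope_sums)
  then show ?thesis unfolding step by (simp add: W_def algebra_simps)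
qed

lemma sums_atLeast_1_int:
  fixes f :: "int \<Rightarrow> 'a::{comm_monoid_add,t2_space}"
  assumes "f summable_on {1..}"
  shows "(\<lambda>j. f (int j + 1)) sums (\<Sum>\<^sub>\<infinity>k\<in>{1..}. f k)"
proof -
  have "((\<lambda>j. f (int j + 1)) has_sum (\<Sum>\<^sub>\<infinity>k\<in>{1..}. f k)) UNIV \<longleftrightarrow> (f has_sum (\<Sum>\<^sub>\<infinity>k\<in>{1..}. f k)) {1..}"
    by (rule has_sum_reindex_bij_witness[of _ "\<lambda>k. nat (k - 1)" "\<lambda>j. int j + 1"]) auto
  then show ?thesis using assms has_sum_imp_sums by fastforce
qed

text \<open>Half-integers add up to integers: \<open>M + 1/2\<close> plus \<open>j + 1/2\<close> is
  \<open>M + (j + 1)\<close>, hence the half line \<open>{1..}\<close>. On the diagonal this is the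
  defining series with the powers of \<open>q\<close> absorbed into \<open>c\<close>; off the
  diagonal the quotient is expanded by \<open>hahn_exton_christoffel_darboux\<close>.\<close>

lemma q_bessel_kernel_eq:
  assumes q: "0 < q" "q < 1" and \<xi>: "0 < \<xi>" "\<xi> < 1"
  defines "c \<equiv> qbessel_coeff q \<xi>"
  shows "q_bessel_kernel q \<xi> (of_int M + 1 / 2) (of_int L + 1 / 2) =
    (\<Sum>\<^sub>\<infinity>k\<in>{1..}. c (M + k) * c (L + k))"
proof -
  define J where "J = hahn_exton_J q (2 * \<xi>)"
  define S where "S = (\<Sum>\<^sub>\<infinity>k\<in>{1..}. c (M + k) * c (L + k))"
  have "(\<lambda>m. c (m + (M - L)) * c m) summable_on UNIV"
    unfolding c_def using qbessel_coeff_orthonormal[OF q \<xi>] has_sum_imp_summable by blast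
  also have "?this \<longleftrightarrow> (\<lambda>k. c (M + k) * c (L + k)) summable_on UNIV"
    by (rule summable_on_reindex_bij_witness[of _ "\<lambda>k. L + k" "\<lambda>m. m - L"]) (auto simp: algebra_simps)
  finally have sm: "(\<lambda>k. c (M + k) * c (L + k)) summable_on {1..}"
    by (rule summable_on_subset_banach) auto
  have sums: "(\<lambda>j. c (M + (int j + 1)) * c (L + (int j + 1))) sums S"
    unfolding S_def by (rule sums_atLeast_1_int[OF sm])
  have sq: "sqrt q powi n = q powr (of_int n / 2)" for n
    using q by (simp add: powr_real_of_int' powr_half_sqrt[symmetric] powr_powr flip: powr_real_of_int')
  have cJ: "c n = q powr (of_int n / 2) * J n" for n
    by (simp add: c_def qbessel_coeff_def J_def sq)
  show ?thesis
  proof (cases "M = L")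
    case True
    have fl: "\<lfloor>real_of_int L + 1 / 2 + (real j + 1 / 2)\<rfloor> = L + (int j + 1)" for j
      by (rule floor_unique) auto
    have avg: "(real_of_int L + 1 / 2 + (real_of_int L + 1 / 2)) / 2 = of_int L + 1 / 2"
      by simp
    have t: "q powr (real j + 1 / 2) * J (L + (int j + 1)) * J (L + (int j + 1)) =
        q powr - (of_int L + 1 / 2) * (c (M + (int j + 1)) * c (L + (int j + 1)))" for j
    proof -
      have e: "q powr - (of_int L + 1 / 2) * (q powr (of_int (L + (int j + 1)) / 2) * q powr (of_int (L + (int j + 1)) / 2)) =
          q powr (real j + 1 / 2)"
        unfolding powr_add[symmetric] by (rule arg_cong[of _ _ "\<lambda>y. q powr y"]) (simp add: field_simps)
      show ?thesis unfolding cJ True e[symmetric] by (simp only: mult_ac)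
    qed
    have "(\<Sum>j. q powr - (of_int L + 1 / 2) * (c (M + (int j + 1)) * c (L + (int j + 1)))) =
        q powr - (of_int L + 1 / 2) * S"
      by (intro sums_unique[symmetric] sums_mult sums)
    then have "q_bessel_kernel q \<xi> (of_int M + 1 / 2) (of_int L + 1 / 2) =
        q powr (of_int L + 1 / 2) * (q powr - (of_int L + 1 / 2) * S)"
      unfolding q_bessel_kernel_def Let_def J_def[symmetric] True fl t[unfolded True] avg by simp
    also have "\<dots> = S"
      using q by (simp add: powr_minus del: minus_add_distrib)
    finally show ?thesis by (simp add: S_def)
  next
    case False
    let ?d = "(of_int M - of_int L) / 2 :: real"
    have fl: "\<lfloor>real_of_int n + 1 / 2 + 1 / 2\<rfloor> = n + 1" "\<lfloor>real_of_int n + 1 / 2 - 1 / 2\<rfloor> = n" for n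
      by (simp_all add: floor_unique)
    have "q powr ?d - q powr (- ?d) \<noteq> 0"
      using q False by (simp add: powr_inj)
    moreover have "\<xi> * (J (M + 1) * J L - J M * J (L + 1)) = (q powr ?d - q powr (- ?d)) * S"
    proof -
      have qi: "q powi n = q powr (of_int n)" for n using q by (simp add: powr_real_of_int')
      have "(q powi (M + int k + 1) - q powi (L + int k + 1)) * (J (M + int k + 1) * J (L + int k + 1)) =
          (q powr ?d - q powr (- ?d)) * (c (M + (int k + 1)) * c (L + (int k + 1)))" for k
      proof -
        \<comment> \<open>Both exponents are written as their mean plus or minus \<open>?d\<close>,
          half their difference; the mean supplies the two powers of \<open>sqrt q\<close> contained
          in \<open>c\<close>.\<close>
        have split_exponents: "of_int (M + int k + 1) =
            ?d + (of_int (M + (int k + 1)) / 2 + of_int (L + (int k + 1)) / 2)"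
          "of_int (L + int k + 1) =
            - ?d + (of_int (M + (int k + 1)) / 2 + of_int (L + (int k + 1)) / 2)"
          by (simp_all add: field_simps)
        have "q powi (M + int k + 1) - q powi (L + int k + 1) = (q powr ?d - q powr (- ?d)) *
            (q powr (of_int (M + (int k + 1)) / 2) * q powr (of_int (L + (int k + 1)) / 2))"
          unfolding qi split_exponents left_diff_distrib powr_add[symmetric] ..
        then show ?thesis unfolding cJ by (simp add: add_ac)
      qed
      then have "(\<lambda>k. (q powr ?d - q powr (- ?d)) * (c (M + (int k + 1)) * c (L + (int k + 1)))) sums
          (\<xi> * (J (M + 1) * J L - J M * J (L + 1)))"
        using hahn_exton_christoffel_darboux[OF q \<xi>, of M L] by (simp add: J_def)
      moreover have "(\<lambda>k. (q powr ?d - q powr (- ?d)) * (c (M + (int k + 1)) * c (L + (int k + 1)))) sums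
          ((q powr ?d - q powr (- ?d)) * S)"
        by (intro sums_mult sums)
      ultimately show ?thesis by (rule sums_unique2)
    qed
    ultimately show ?thesis
      using False unfolding q_bessel_kernel_def Let_def J_def[symmetric] fl S_def[symmetric] by simp
  qed
qed

subsection \<open>Toeplitz operators on square-summable sequences\<close>

definition l2 :: "(int \<Rightarrow> real) \<Rightarrow> bool" where
  "l2 y \<longleftrightarrow> (\<lambda>k. (y k)\<^sup>2) summable_on UNIV"

text \<open>For a proper subset \<open>D\<close> this is the form of the coordinate projection onto
  \<open>D\<close>; all statements about restrictions are phrased through it.\<close>

definition ip :: "int set \<Rightarrow> (int \<Rightarrow> real) \<Rightarrow> (int \<Rightarrow> real) \<Rightarrow> real" where
  "ip D y z = (\<Sum>\<^sub>\<infinity>k\<in>D. y k * z k)"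

lemma l2_mult_summable:
  assumes "l2 y" "l2 z"
  shows "(\<lambda>k. y k * z k) summable_on D"
proof -
  have "(\<lambda>k. norm (y k * z k)) summable_on UNIV"
  proof (rule summable_on_comparison_test)
    show "(\<lambda>k. (y k)\<^sup>2 + (z k)\<^sup>2) summable_on UNIV"
      using assms by (intro summable_on_add) (auto simp: l2_def)
    show "norm (y k * z k) \<le> (y k)\<^sup>2 + (z k)\<^sup>2" for k
    proof -
      have "0 \<le> \<bar>y k\<bar> * \<bar>z k\<bar>" "2 * \<bar>y k\<bar> * \<bar>z k\<bar> \<le> (y k)\<^sup>2 + (z k)\<^sup>2"
        using sum_squares_bound[of "\<bar>y k\<bar>" "\<bar>z k\<bar>"] by simp_all
      then show ?thesis unfolding real_norm_def abs_mult by linarith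
    qed
  qed auto
  then have "(\<lambda>k. y k * z k) summable_on UNIV"
    by (rule iffD2[OF summable_on_iff_abs_summable_on_real])
  then show ?thesis by (rule summable_on_subset_banach) simp
qed

lemma l2_lincomb:
  assumes "l2 y" "l2 z"
  shows "l2 (\<lambda>k. a * y k + b * z k)"
proof -
  have "(\<lambda>k. a\<^sup>2 * (y k * y k) + (2 * a * b) * (y k * z k) + b\<^sup>2 * (z k * z k)) summable_on UNIV"
    by (intro summable_on_add summable_on_cmult_right l2_mult_summable assms)
  then show ?thesis
    by (simp add: l2_def power2_eq_square algebra_simps)
qed

lemma l2_zero: "l2 (\<lambda>k. 0)"
  by (simp add: l2_def)

lemma l2_scale: "l2 y \<Longrightarrow> l2 (\<lambda>k. a * y k)"
  using l2_lincomb[of y y a 0] by simp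

lemma l2_shift: "l2 y \<Longrightarrow> l2 (\<lambda>k. y (k + d))"
  unfolding l2_def summable_on_def by (metis has_sum_shift_int[of "\<lambda>k. (y k)\<^sup>2"])

lemma ip_lincomb_left:
  assumes "l2 y" "l2 z" "l2 x"
  shows "ip D (\<lambda>k. a * y k + b * z k) x = a * ip D y x + b * ip D z x"
proof -
  have "ip D (\<lambda>k. a * y k + b * z k) x = (\<Sum>\<^sub>\<infinity>k\<in>D. a * (y k * x k) + b * (z k * x k))"
    by (simp add: ip_def algebra_simps)
  also have "\<dots> = a * ip D y x + b * ip D z x"
    unfolding ip_def using assms
    by (subst infsum_add) (auto intro!: summable_on_cmult_right l2_mult_summable simp: infsum_cmult_right')
  finally show ?thesis .
qed

lemma ip_commute: "ip D y z = ip D z y"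
  by (simp add: ip_def mult.commute)

lemma ip_lincomb_right:
  assumes "l2 y" "l2 z" "l2 x"
  shows "ip D x (\<lambda>k. a * y k + b * z k) = a * ip D x y + b * ip D x z"
  using ip_lincomb_left[OF assms] by (simp add: ip_commute[of D x])

lemma ip_zero: "ip D (\<lambda>k. 0) z = 0"
  by (simp add: ip_def)

lemma ip_self_nonneg: "0 \<le> ip D y y"
  by (simp add: ip_def infsum_nonneg)

lemma ip_shift: "ip UNIV (\<lambda>k. y (k + d)) (\<lambda>k. z (k + d)) = ip UNIV y z"
  unfolding ip_def
  by (rule infsum_reindex_bij_witness[of _ "\<lambda>n. n - d" "\<lambda>n. n + d"]) auto

lemma ip_self_mono: "l2 y \<Longrightarrow> ip D y y \<le> ip UNIV y y"
  unfolding ip_def by (intro infsum_mono2 l2_mult_summable) auto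

lemma ip_split:
  assumes "l2 y" "l2 z"
  shows "ip D y z + ip (- D) y z = ip UNIV y z"
  using infsum_Un_disjoint[OF l2_mult_summable[OF assms] l2_mult_summable[OF assms], of D "- D"]
  by (simp add: ip_def)

lemma ip_cauchy_schwarz:
  assumes "l2 y" "l2 z"
  shows "(ip D y z)\<^sup>2 \<le> ip UNIV y y * ip UNIV z z"
proof -
  have quad: "0 \<le> ip D y y + 2 * t * ip D y z + t\<^sup>2 * ip D z z" for t
  proof -
    have "l2 (\<lambda>k. 1 * y k + t * z k)" using assms by (rule l2_lincomb)
    then have "ip D (\<lambda>k. 1 * y k + t * z k) (\<lambda>k. 1 * y k + t * z k) =
        ip D y y + 2 * t * ip D y z + t\<^sup>2 * ip D z z"
      using assms by (simp only: ip_lincomb_left ip_lincomb_right ip_commute[of D z y])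
        (simp add: power2_eq_square algebra_simps)
    then show ?thesis using ip_self_nonneg by metis
  qed
  have "(ip D y z)\<^sup>2 \<le> ip D y y * ip D z z"
  proof (cases "ip D z z = 0")
    case True
    have "ip D y z = 0"
    proof (rule ccontr)
      assume nz: "ip D y z \<noteq> 0"
      \<comment> \<open>This value of \<open>t\<close> makes the affine function in
        \<open>quad\<close> equal to -1.\<close>
      have "0 \<le> ip D y y + 2 * (- (ip D y y + 1) / (2 * ip D y z)) * ip D y z"
        using quad[of "- (ip D y y + 1) / (2 * ip D y z)"] True by simp
      moreover have "2 * (- (ip D y y + 1) / (2 * ip D y z)) * ip D y z = - (ip D y y + 1)"
        using nz by simp
      ultimately show False by linarith
    qed
    then show ?thesis using True by simp
  next
    case False
    then have pos: "ip D z z > 0" using ip_self_nonneg[of D z] by simp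
    have "0 \<le> ip D y y - (ip D y z)\<^sup>2 / ip D z z"
      using quad[of "- ip D y z / ip D z z"] False by (simp add: power2_eq_square field_simps)
    then show ?thesis using pos by (simp add: field_simps)
  qed
  also have "\<dots> \<le> ip UNIV y y * ip UNIV z z"
    by (intro mult_mono ip_self_mono assms ip_self_nonneg)
  finally show ?thesis .
qed

section \<open>Polynomials in the Toeplitz operator and their spectral integrals\<close>

definition toeplitz :: "real \<Rightarrow> (int \<Rightarrow> real) \<Rightarrow> int \<Rightarrow> real" where
  "toeplitz \<xi> y k = (1 + \<xi>\<^sup>2) * y k - \<xi> * (y (k + 1) + y (k - 1))"

text \<open>This is \<open>p(A) y\<close>, evaluated by Horner's rule.\<close>

definition poly_toeplitz :: "real \<Rightarrow> real poly \<Rightarrow> (int \<Rightarrow> real) \<Rightarrow> int \<Rightarrow> real" where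
  "poly_toeplitz \<xi> p = fold_coeffs (\<lambda>a f y k. a * y k + toeplitz \<xi> (f y) k) p (\<lambda>y k. 0)"

lemma toeplitz_zero [simp]: "toeplitz \<xi> (\<lambda>k. 0) = (\<lambda>k. 0)"
  by (simp add: toeplitz_def fun_eq_iff)

lemma poly_toeplitz_0 [simp]: "poly_toeplitz \<xi> 0 y = (\<lambda>k. 0)"
  by (simp add: poly_toeplitz_def)

lemma poly_toeplitz_pCons [simp]:
  "poly_toeplitz \<xi> (pCons a p) y = (\<lambda>k. a * y k + toeplitz \<xi> (poly_toeplitz \<xi> p y) k)"
  by (cases "p = 0 \<and> a = 0") (auto simp: poly_toeplitz_def)

lemma toeplitz_lincomb:
  "toeplitz \<xi> (\<lambda>k. a * y k + b * z k) = (\<lambda>k. a * toeplitz \<xi> y k + b * toeplitz \<xi> z k)"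
  by (simp add: toeplitz_def fun_eq_iff algebra_simps)

lemma toeplitz_add:
  "toeplitz \<xi> (\<lambda>k. y k + z k) = (\<lambda>k. toeplitz \<xi> y k + toeplitz \<xi> z k)"
  and toeplitz_scale: "toeplitz \<xi> (\<lambda>k. a * y k) = (\<lambda>k. a * toeplitz \<xi> y k)"
  by (simp_all add: toeplitz_def fun_eq_iff algebra_simps)

lemma poly_toeplitz_lincomb:
  "poly_toeplitz \<xi> p (\<lambda>k. a * y k + b * z k) =
    (\<lambda>k. a * poly_toeplitz \<xi> p y k + b * poly_toeplitz \<xi> p z k)"
  by (induction p) (auto simp: toeplitz_lincomb algebra_simps)

lemma poly_toeplitz_add:
  "poly_toeplitz \<xi> (p + p') y = (\<lambda>k. poly_toeplitz \<xi> p y k + poly_toeplitz \<xi> p' y k)"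
proof (induction p arbitrary: p')
  case (pCons a p)
  obtain b r where "p' = pCons b r" by (cases p')
  then show ?case using pCons.IH[of r] by (simp add: toeplitz_add) (simp add: algebra_simps)
qed simp

lemma poly_toeplitz_smult: "poly_toeplitz \<xi> (smult c p) y = (\<lambda>k. c * poly_toeplitz \<xi> p y k)"
  by (induction p) (auto simp: toeplitz_scale algebra_simps)

lemma toeplitz_poly_toeplitz:
  "toeplitz \<xi> (poly_toeplitz \<xi> p y) = poly_toeplitz \<xi> p (toeplitz \<xi> y)"
proof (induction p)
  case (pCons a p)
  then show ?case using toeplitz_lincomb[of \<xi> a y 1] by simp
qed simp

lemma poly_toeplitz_mult: "poly_toeplitz \<xi> (p * p') y = poly_toeplitz \<xi> p (poly_toeplitz \<xi> p' y)"
proof (induction p)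
  case (pCons a p)
  have "pCons a p * p' = smult a p' + pCons 0 (p * p')" by simp
  then show ?case
    by (simp add: poly_toeplitz_add poly_toeplitz_smult pCons)
qed simp

lemma l2_toeplitz:
  assumes "l2 y"
  shows "l2 (toeplitz \<xi> y)"
proof -
  have "toeplitz \<xi> y = (\<lambda>k. (1 + \<xi>\<^sup>2) * y k + (- \<xi>) * (1 * y (k + 1) + 1 * y (k + (- 1))))"
    by (simp add: toeplitz_def fun_eq_iff)
  then show ?thesis
    by (simp only:) (intro l2_lincomb l2_shift assms)
qed

lemma l2_poly_toeplitz: "l2 y \<Longrightarrow> l2 (poly_toeplitz \<xi> p y)"
  using l2_lincomb[of y "toeplitz \<xi> z" a 1 for a z]
  by (induction p) (auto simp: l2_zero l2_toeplitz)

lemma ip_toeplitz_left: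
  assumes "l2 y" "l2 z"
  shows "ip D (toeplitz \<xi> y) z =
    (1 + \<xi>\<^sup>2) * ip D y z - \<xi> * (ip D (\<lambda>k. y (k + 1)) z + ip D (\<lambda>k. y (k + (- 1))) z)"
proof -
  have "toeplitz \<xi> y = (\<lambda>k. (1 + \<xi>\<^sup>2) * y k + (- \<xi>) * (1 * y (k + 1) + 1 * y (k + (- 1))))"
    by (simp add: toeplitz_def fun_eq_iff)
  then show ?thesis
    using assms by (simp only: ip_lincomb_left l2_lincomb l2_shift) (simp add: algebra_simps)
qed

text \<open>The shifts by 1 and -1 are adjoint to each other on the whole of the integers. On a half
  line a boundary term remains; there symmetry is available only asymptotically, see
  \<open>toeplitz_asymp_symmetric\<close>.\<close>

lemma toeplitz_symmetric:
  assumes "l2 y" "l2 z"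
  shows "ip UNIV (toeplitz \<xi> y) z = ip UNIV y (toeplitz \<xi> z)"
proof -
  have "ip UNIV (\<lambda>k. y (k + d)) z = ip UNIV y (\<lambda>k. z (k + (- d)))" for d
    using ip_shift[of y d "\<lambda>k. z (k + (- d))"] by simp
  from this[of 1] this[of "- 1"] show ?thesis
    using ip_toeplitz_left[OF assms, of UNIV \<xi>] ip_toeplitz_left[OF assms(2,1), of UNIV \<xi>]
    by (simp add: ip_commute[of _ y] algebra_simps)
qed

lemma poly_toeplitz_symmetric:
  assumes "l2 y" "l2 z"
  shows "ip UNIV (poly_toeplitz \<xi> p y) z = ip UNIV y (poly_toeplitz \<xi> p z)"
  using assms(2)
proof (induction p arbitrary: z)
  case (pCons a p)
  note l = assms(1) pCons.prems l2_poly_toeplitz l2_toeplitz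
  have "ip UNIV (poly_toeplitz \<xi> (pCons a p) y) z =
      a * ip UNIV y z + 1 * ip UNIV (toeplitz \<xi> (poly_toeplitz \<xi> p y)) z"
    using ip_lincomb_left[of y "toeplitz \<xi> (poly_toeplitz \<xi> p y)" z UNIV a 1] l by simp
  also have "ip UNIV (toeplitz \<xi> (poly_toeplitz \<xi> p y)) z = ip UNIV (poly_toeplitz \<xi> p y) (toeplitz \<xi> z)"
    using l by (intro toeplitz_symmetric) auto
  also have "\<dots> = ip UNIV y (poly_toeplitz \<xi> p (toeplitz \<xi> z))"
    using l by (intro pCons.IH) auto
  also have "poly_toeplitz \<xi> p (toeplitz \<xi> z) = toeplitz \<xi> (poly_toeplitz \<xi> p z)"
    by (simp add: toeplitz_poly_toeplitz)
  also have "a * ip UNIV y z + 1 * ip UNIV y (toeplitz \<xi> (poly_toeplitz \<xi> p z)) =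
      ip UNIV y (poly_toeplitz \<xi> (pCons a p) z)"
    using ip_lincomb_right[of z "toeplitz \<xi> (poly_toeplitz \<xi> p z)" y UNIV a 1] l by simp
  finally show ?case .
qed (simp add: ip_def)

definition symbol :: "real \<Rightarrow> real \<Rightarrow> real" where
  "symbol \<xi> \<theta> = 1 + \<xi>\<^sup>2 - 2 * \<xi> * cos \<theta>"

lemma has_integral_cos_int:
  "((\<lambda>\<theta>. cos (of_int m * \<theta>)) has_integral (if m = 0 then pi else 0)) {0..pi}"
proof (cases "m = 0")
  case True
  then show ?thesis using has_integral_const_real[of "1::real" 0 pi] by simp
next
  case False
  have "((\<lambda>\<theta>. cos (of_int m * \<theta>)) has_integral (sin (of_int m * pi) / of_int m - sin (of_int m * 0) / of_int m)) {0..pi}"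
    by (rule fundamental_theorem_of_calculus)
      (use False in \<open>auto intro!: derivative_eq_intros simp flip: has_real_derivative_iff_has_vector_derivative\<close>)
  moreover have "sin (of_int m * pi) = 0"
    using sin_integer_2pi[of "of_int m / 2"] sin_zero_iff_int2 by blast
  ultimately show ?thesis using False by simp
qed

text \<open>As the shifts of \<open>c\<close> are orthonormal, sending them to the exponentials is
  isometric and turns \<open>A\<close> into multiplication by its symbol; the symbol is even, so
  half a period of cosines is enough. The induction runs over all \<open>i\<close>, because
  \<open>A\<close> moves the index \<open>i\<close> to its neighbours.\<close>

lemma poly_toeplitz_has_integral:
  assumes c: "\<And>d. ((\<lambda>m. c (m + d) * c m) has_sum (if d = 0 then 1 else 0)) UNIV"
  shows "((\<lambda>\<theta>. poly p (symbol \<xi> \<theta>) * cos (of_int (i - j) * \<theta>)) has_integral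
    pi * ip UNIV (poly_toeplitz \<xi> p (\<lambda>k. c (i + k))) (\<lambda>k. c (j + k))) {0..pi}"
proof (induction p arbitrary: i)
  case 0
  then show ?case by (simp add: ip_zero)
next
  case (pCons a p)
  let ?y = "\<lambda>i k. c (i + k)"
  have l0: "l2 c"
    using c[of 0] by (auto simp: l2_def power2_eq_square dest: has_sum_imp_summable)
  have l: "l2 (?y i)" for i
    using l2_shift[OF l0, of i] by (simp add: add.commute)
  have o: "ip UNIV (?y i) (?y j) = (if i - j = 0 then 1 else 0)"
  proof -
    have "ip UNIV (?y i) (?y j) = (\<Sum>\<^sub>\<infinity>m. c (m + (i - j)) * c m)"
      unfolding ip_def
      by (rule infsum_reindex_bij_witness[of _ "\<lambda>m. m - j" "\<lambda>k. j + k"]) (auto simp: algebra_simps)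
    then show ?thesis using infsumI[OF c[of "i - j"]] by simp
  qed
  have T: "toeplitz \<xi> (?y i) = (\<lambda>k. (1 + \<xi>\<^sup>2) * ?y i k + (- \<xi>) * (1 * ?y (i + 1) k + 1 * ?y (i - 1) k))"
    by (simp add: toeplitz_def fun_eq_iff algebra_simps)
  have "ip UNIV (poly_toeplitz \<xi> (pCons a p) (?y i)) (?y j) =
      a * ip UNIV (?y i) (?y j) + 1 * ip UNIV (poly_toeplitz \<xi> p (toeplitz \<xi> (?y i))) (?y j)"
    using ip_lincomb_left[of "?y i" "toeplitz \<xi> (poly_toeplitz \<xi> p (?y i))" "?y j" UNIV a 1]
    by (simp add: l l2_toeplitz l2_poly_toeplitz toeplitz_poly_toeplitz)
  also have "ip UNIV (poly_toeplitz \<xi> p (toeplitz \<xi> (?y i))) (?y j) =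
      (1 + \<xi>\<^sup>2) * ip UNIV (poly_toeplitz \<xi> p (?y i)) (?y j) + (- \<xi>) *
      (1 * ip UNIV (poly_toeplitz \<xi> p (?y (i + 1))) (?y j) + 1 * ip UNIV (poly_toeplitz \<xi> p (?y (i - 1))) (?y j))"
    unfolding T poly_toeplitz_lincomb by (simp only: ip_lincomb_left l2_lincomb l l2_poly_toeplitz)
  finally have X: "ip UNIV (poly_toeplitz \<xi> (pCons a p) (?y i)) (?y j) =
      a * ip UNIV (?y i) (?y j) + 1 * ((1 + \<xi>\<^sup>2) * ip UNIV (poly_toeplitz \<xi> p (?y i)) (?y j) + (- \<xi>) *
      (1 * ip UNIV (poly_toeplitz \<xi> p (?y (i + 1))) (?y j) + 1 * ip UNIV (poly_toeplitz \<xi> p (?y (i - 1))) (?y j)))" .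
  have eq: "pi * ip UNIV (poly_toeplitz \<xi> (pCons a p) (?y i)) (?y j) =
      a * (if i - j = 0 then pi else 0) + (1 + \<xi>\<^sup>2) * (pi * ip UNIV (poly_toeplitz \<xi> p (?y i)) (?y j)) + (- \<xi>) *
      (pi * ip UNIV (poly_toeplitz \<xi> p (?y (i + 1))) (?y j) + pi * ip UNIV (poly_toeplitz \<xi> p (?y (i - 1))) (?y j))"
    unfolding X o by (simp add: algebra_simps)
  \<comment> \<open>The counterpart of \<open>T\<close> on the cosine side: adding the two
    neighbours of \<open>i\<close> multiplies by \<open>2 * cos \<theta>\<close>.\<close>
  have tr: "cos (of_int (i + 1 - j) * \<theta>) + cos (of_int (i - 1 - j) * \<theta>) =
      2 * cos \<theta> * cos (of_int (i - j) * \<theta>)" for \<theta> :: real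
  proof -
    have "of_int (i + 1 - j) * \<theta> = of_int (i - j) * \<theta> + \<theta>" "of_int (i - 1 - j) * \<theta> = of_int (i - j) * \<theta> - \<theta>"
      by (simp_all add: algebra_simps)
    then show ?thesis by (simp only: cos_add cos_diff) simp
  qed
  have "((\<lambda>\<theta>. a * cos (of_int (i - j) * \<theta>) +
      (1 + \<xi>\<^sup>2) * (poly p (symbol \<xi> \<theta>) * cos (of_int (i - j) * \<theta>)) + (- \<xi>) *
      (poly p (symbol \<xi> \<theta>) * cos (of_int (i + 1 - j) * \<theta>) + poly p (symbol \<xi> \<theta>) * cos (of_int (i - 1 - j) * \<theta>)))
      has_integral pi * ip UNIV (poly_toeplitz \<xi> (pCons a p) (?y i)) (?y j)) {0..pi}"
    unfolding eq by (intro has_integral_add has_integral_mult_right has_integral_cos_int pCons.IH)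
  also have "(\<lambda>\<theta>. a * cos (of_int (i - j) * \<theta>) +
      (1 + \<xi>\<^sup>2) * (poly p (symbol \<xi> \<theta>) * cos (of_int (i - j) * \<theta>)) + (- \<xi>) *
      (poly p (symbol \<xi> \<theta>) * cos (of_int (i + 1 - j) * \<theta>) + poly p (symbol \<xi> \<theta>) * cos (of_int (i - 1 - j) * \<theta>))) =
      (\<lambda>\<theta>. poly (pCons a p) (symbol \<xi> \<theta>) * cos (of_int (i - j) * \<theta>))"
    unfolding distrib_left[of "poly p _" "cos _" "cos _", symmetric] tr by (simp add: symbol_def algebra_simps)
  finally show ?case .
qed

subsection \<open>The semiclassical limit\<close>

text \<open>The integer \<open>N q\<close> is the centre and \<alpha> the limiting weight there; for
  \<open>N q\<close> near \<open>- x / ln q\<close> it is \<open>exp (- x)\<close>. A general filter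
  \<open>F\<close> allows \<open>q\<close> to approach 1 through a restricted set only.\<close>

locale bulk_limit =
  fixes F :: "real filter" and \<xi> \<alpha> :: real and N :: "real \<Rightarrow> int"
  assumes xi: "0 < \<xi>" "\<xi> < 1"
    and q_ev: "\<forall>\<^sub>F q in F. 0 < q \<and> q < 1"
    and q_lim: "((\<lambda>q. q) \<longlongrightarrow> 1) F"
    and qN_lim: "((\<lambda>q. q powi N q) \<longlongrightarrow> \<alpha>) F"
begin

definition bounded_family :: "(real \<Rightarrow> int \<Rightarrow> real) \<Rightarrow> bool" where
  "bounded_family y \<longleftrightarrow> (\<exists>B. \<forall>\<^sub>F q in F. l2 (y q) \<and> ip UNIV (y q) (y q) \<le> B)"

definition negligible_family :: "(real \<Rightarrow> int \<Rightarrow> real) \<Rightarrow> bool" where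
  "negligible_family y \<longleftrightarrow> (\<forall>\<^sub>F q in F. l2 (y q)) \<and> ((\<lambda>q. ip UNIV (y q) (y q)) \<longlongrightarrow> 0) F"

definition weighted :: "(real \<Rightarrow> int \<Rightarrow> real) \<Rightarrow> real \<Rightarrow> int \<Rightarrow> real" where
  "weighted y q k = q powi (N q + k) * y q k"

text \<open>The relation persists under linear combinations and under polynomials in
  \<open>A\<close>; besides the spectral measure it is all that the half line argument uses about
  \<open>y\<close>.\<close>

definition asymptotic_eigenfamily :: "(real \<Rightarrow> int \<Rightarrow> real) \<Rightarrow> bool" where
  "asymptotic_eigenfamily y \<longleftrightarrow>
    bounded_family y \<and> negligible_family (\<lambda>q k. toeplitz \<xi> (y q) k - weighted y q k)"

lemma ip_lincomb_self_le:
  assumes "l2 y" "l2 z"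
  shows "ip UNIV (\<lambda>k. a * y k + b * z k) (\<lambda>k. a * y k + b * z k) \<le>
    2 * a\<^sup>2 * ip UNIV y y + 2 * b\<^sup>2 * ip UNIV z z"
proof -
  have sum: "2 * a\<^sup>2 * ip UNIV y y + 2 * b\<^sup>2 * ip UNIV z z = (\<Sum>\<^sub>\<infinity>k. 2 * a\<^sup>2 * (y k * y k) + 2 * b\<^sup>2 * (z k * z k))"
    unfolding ip_def using assms
    by (subst infsum_add) (auto intro!: summable_on_cmult_right l2_mult_summable simp: infsum_cmult_right')
  show ?thesis unfolding sum unfolding ip_def
  proof (rule infsum_mono)
    show "(\<lambda>k. (a * y k + b * z k) * (a * y k + b * z k)) summable_on UNIV"
      by (intro l2_mult_summable l2_lincomb assms)
    show "(\<lambda>k. 2 * a\<^sup>2 * (y k * y k) + 2 * b\<^sup>2 * (z k * z k)) summable_on UNIV"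
      by (intro summable_on_add summable_on_cmult_right l2_mult_summable assms)
    show "(a * y k + b * z k) * (a * y k + b * z k) \<le> 2 * a\<^sup>2 * (y k * y k) + 2 * b\<^sup>2 * (z k * z k)" for k
      using zero_le_power2[of "a * y k - b * z k"] by (simp add: power2_eq_square algebra_simps)
  qed
qed

lemma bounded_family_lincomb:
  assumes "bounded_family y" "bounded_family z"
  shows "bounded_family (\<lambda>q k. a * y q k + b * z q k)"
proof -
  obtain B C where "\<forall>\<^sub>F q in F. l2 (y q) \<and> ip UNIV (y q) (y q) \<le> B"
    "\<forall>\<^sub>F q in F. l2 (z q) \<and> ip UNIV (z q) (z q) \<le> C"
    using assms by (auto simp: bounded_family_def)
  then have "\<forall>\<^sub>F q in F. l2 (\<lambda>k. a * y q k + b * z q k) \<and>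
      ip UNIV (\<lambda>k. a * y q k + b * z q k) (\<lambda>k. a * y q k + b * z q k) \<le> 2 * a\<^sup>2 * B + 2 * b\<^sup>2 * C"
  proof eventually_elim
    case (elim q)
    have "2 * a\<^sup>2 * ip UNIV (y q) (y q) + 2 * b\<^sup>2 * ip UNIV (z q) (z q) \<le> 2 * a\<^sup>2 * B + 2 * b\<^sup>2 * C"
      using elim by (intro add_mono mult_left_mono) auto
    then show ?case
      using elim l2_lincomb[of "y q" "z q" a b] ip_lincomb_self_le[of "y q" "z q" a b] by linarith
  qed
  then show ?thesis unfolding bounded_family_def by blast
qed

lemma negligible_family_lincomb:
  assumes "negligible_family y" "negligible_family z"
  shows "negligible_family (\<lambda>q k. a * y q k + b * z q k)"
proof -
  have l: "\<forall>\<^sub>F q in F. l2 (y q)" "\<forall>\<^sub>F q in F. l2 (z q)"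
    and lim: "((\<lambda>q. ip UNIV (y q) (y q)) \<longlongrightarrow> 0) F" "((\<lambda>q. ip UNIV (z q) (z q)) \<longlongrightarrow> 0) F"
    using assms by (auto simp: negligible_family_def)
  have "((\<lambda>q. ip UNIV (\<lambda>k. a * y q k + b * z q k) (\<lambda>k. a * y q k + b * z q k)) \<longlongrightarrow> 0) F"
  proof (rule tendsto_sandwich)
    show "\<forall>\<^sub>F q in F. 0 \<le> ip UNIV (\<lambda>k. a * y q k + b * z q k) (\<lambda>k. a * y q k + b * z q k)"
      by (simp add: ip_self_nonneg)
    show "\<forall>\<^sub>F q in F. ip UNIV (\<lambda>k. a * y q k + b * z q k) (\<lambda>k. a * y q k + b * z q k) \<le>
        2 * a\<^sup>2 * ip UNIV (y q) (y q) + 2 * b\<^sup>2 * ip UNIV (z q) (z q)"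
      using l by eventually_elim (rule ip_lincomb_self_le)
    have "((\<lambda>q. 2 * a\<^sup>2 * ip UNIV (y q) (y q) + 2 * b\<^sup>2 * ip UNIV (z q) (z q)) \<longlongrightarrow> 2 * a\<^sup>2 * 0 + 2 * b\<^sup>2 * 0) F"
      by (intro tendsto_intros lim)
    then show "((\<lambda>q. 2 * a\<^sup>2 * ip UNIV (y q) (y q) + 2 * b\<^sup>2 * ip UNIV (z q) (z q)) \<longlongrightarrow> 0) F" by simp
  qed simp
  moreover have "\<forall>\<^sub>F q in F. l2 (\<lambda>k. a * y q k + b * z q k)"
    using l by eventually_elim (rule l2_lincomb)
  ultimately show ?thesis by (simp add: negligible_family_def)
qed

lemma negligible_family_scale:
  assumes "bounded_family y" "(s \<longlongrightarrow> 0) F"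
  shows "negligible_family (\<lambda>q k. s q * y q k)"
proof -
  obtain B where B: "\<forall>\<^sub>F q in F. l2 (y q) \<and> ip UNIV (y q) (y q) \<le> B"
    using assms by (auto simp: bounded_family_def)
  have eq: "ip UNIV (\<lambda>k. s q * y q k) (\<lambda>k. s q * y q k) = (s q)\<^sup>2 * ip UNIV (y q) (y q)" for q
    unfolding ip_def by (simp add: power2_eq_square algebra_simps flip: infsum_cmult_right')
  have "((\<lambda>q. ip UNIV (\<lambda>k. s q * y q k) (\<lambda>k. s q * y q k)) \<longlongrightarrow> 0) F"
  proof (rule tendsto_sandwich)
    show "\<forall>\<^sub>F q in F. 0 \<le> ip UNIV (\<lambda>k. s q * y q k) (\<lambda>k. s q * y q k)"
      by (simp add: ip_self_nonneg)
    show "\<forall>\<^sub>F q in F. ip UNIV (\<lambda>k. s q * y q k) (\<lambda>k. s q * y q k) \<le> (s q)\<^sup>2 * B"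
      unfolding eq using B by eventually_elim (auto intro: mult_left_mono)
    have "((\<lambda>q. (s q)\<^sup>2 * B) \<longlongrightarrow> 0\<^sup>2 * B) F"
      by (intro tendsto_intros assms)
    then show "((\<lambda>q. (s q)\<^sup>2 * B) \<longlongrightarrow> 0) F" by simp
  qed simp
  moreover have "\<forall>\<^sub>F q in F. l2 (\<lambda>k. s q * y q k)"
    using B by eventually_elim (auto intro: l2_scale)
  ultimately show ?thesis by (simp add: negligible_family_def)
qed

lemma negligible_imp_bounded: "negligible_family y \<Longrightarrow> bounded_family y"
proof -
  assume *: "negligible_family y"
  then have "\<forall>\<^sub>F q in F. ip UNIV (y q) (y q) < 1" "\<forall>\<^sub>F q in F. l2 (y q)"
    by (auto simp: negligible_family_def intro: order_tendstoD)
  then have "\<forall>\<^sub>F q in F. l2 (y q) \<and> ip UNIV (y q) (y q) \<le> 1"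
    by eventually_elim auto
  then show ?thesis unfolding bounded_family_def by blast
qed

lemma bounded_family_shift: "bounded_family y \<Longrightarrow> bounded_family (\<lambda>q k. y q (k + d))"
  unfolding bounded_family_def ip_shift by (elim exE, rule exI, erule eventually_mono) (auto intro: l2_shift)

lemma negligible_family_shift: "negligible_family y \<Longrightarrow> negligible_family (\<lambda>q k. y q (k + d))"
  unfolding negligible_family_def ip_shift by (elim conjE, rule conjI, erule eventually_mono) (auto intro: l2_shift)

lemma toeplitz_as_lincomb:
  "toeplitz \<xi> y = (\<lambda>k. (1 + \<xi>\<^sup>2) * y k + (- \<xi>) * (1 * y (k + 1) + 1 * y (k + (- 1))))"
  by (simp add: toeplitz_def fun_eq_iff)

lemma bounded_family_toeplitz: "bounded_family y \<Longrightarrow> bounded_family (\<lambda>q. toeplitz \<xi> (y q))"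
  unfolding toeplitz_as_lincomb by (intro bounded_family_lincomb bounded_family_shift)

lemma negligible_family_toeplitz: "negligible_family y \<Longrightarrow> negligible_family (\<lambda>q. toeplitz \<xi> (y q))"
  unfolding toeplitz_as_lincomb by (intro negligible_family_lincomb negligible_family_shift)

lemma negligible_family_cong:
  assumes "\<forall>\<^sub>F q in F. y q = z q" "negligible_family y"
  shows "negligible_family z"
proof -
  have "((\<lambda>q. ip UNIV (z q) (z q)) \<longlongrightarrow> 0) F"
    by (rule Lim_transform_eventually[of "\<lambda>q. ip UNIV (y q) (y q)"])
      (use assms in \<open>auto simp: negligible_family_def elim: eventually_mono\<close>)
  moreover have "\<forall>\<^sub>F q in F. l2 (z q)"
    using assms(2)[unfolded negligible_family_def, THEN conjunct1] assms(1) by eventually_elim simp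
  ultimately show ?thesis by (simp add: negligible_family_def)
qed

text \<open>The weight grows without bound as \<open>k\<close> tends to minus infinity, so
  boundedness of \<open>y\<close> alone would not give this; it is read off from \<open>A y\<close>,
  which is bounded.\<close>

lemma bounded_family_weighted:
  assumes "asymptotic_eigenfamily y"
  shows "bounded_family (weighted y)"
proof -
  have "bounded_family (\<lambda>q k. 1 * toeplitz \<xi> (y q) k + (- 1) * (toeplitz \<xi> (y q) k - weighted y q k))"
    by (rule bounded_family_lincomb[OF bounded_family_toeplitz negligible_imp_bounded])
      (use assms in \<open>auto simp: asymptotic_eigenfamily_def\<close>)
  then show ?thesis by simp
qed

lemma asymptotic_eigenfamily_lincomb:
  assumes "asymptotic_eigenfamily y" "asymptotic_eigenfamily z"
  shows "asymptotic_eigenfamily (\<lambda>q k. a * y q k + b * z q k)"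
proof -
  have "negligible_family (\<lambda>q k. a * (toeplitz \<xi> (y q) k - weighted y q k) + b * (toeplitz \<xi> (z q) k - weighted z q k))"
    using assms by (intro negligible_family_lincomb) (auto simp: asymptotic_eigenfamily_def)
  also have "(\<lambda>q k. a * (toeplitz \<xi> (y q) k - weighted y q k) + b * (toeplitz \<xi> (z q) k - weighted z q k)) =
      (\<lambda>q k. toeplitz \<xi> (\<lambda>k. a * y q k + b * z q k) k - weighted (\<lambda>q k. a * y q k + b * z q k) q k)"
    by (simp add: toeplitz_lincomb weighted_def fun_eq_iff algebra_simps)
  finally show ?thesis
    using assms by (simp add: asymptotic_eigenfamily_def bounded_family_lincomb)
qed

text \<open>The weight \<open>q\<^sup>N\<^sup>+\<^sup>k\<close> varies so slowly in \<open>k\<close> that it commutes with shifts up to a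
  factor \<open>1 - q\<close>.\<close>

lemma asymptotic_eigenfamily_toeplitz:
  assumes "asymptotic_eigenfamily y"
  shows "asymptotic_eigenfamily (\<lambda>q. toeplitz \<xi> (y q))"
proof -
  note b = bounded_family_weighted[OF assms]
  have lim: "((\<lambda>q. 1 - 1 / q) \<longlongrightarrow> 0) F" "((\<lambda>q. 1 - q) \<longlongrightarrow> 0) F"
    using tendsto_diff[OF tendsto_const[of 1] tendsto_divide[OF tendsto_const[of 1] q_lim]]
      tendsto_diff[OF tendsto_const[of 1] q_lim] by simp_all
  \<comment> \<open>The terms with the factor \<open>- \<xi>\<close> are the commutator of
    \<open>A\<close> with the weight, applied to \<open>y\<close>.\<close>
  have n: "negligible_family (\<lambda>q k. 1 * toeplitz \<xi> (\<lambda>k. toeplitz \<xi> (y q) k - weighted y q k) k +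
      (- \<xi>) * (1 * ((1 - 1 / q) * weighted y q (k + 1)) + 1 * ((1 - q) * weighted y q (k + (- 1)))))"
    by (intro negligible_family_lincomb negligible_family_toeplitz negligible_family_scale
        lim bounded_family_shift b) (use assms in \<open>auto simp: asymptotic_eigenfamily_def\<close>)
  have "\<forall>\<^sub>F q in F. (\<lambda>k. 1 * toeplitz \<xi> (\<lambda>k. toeplitz \<xi> (y q) k - weighted y q k) k +
      (- \<xi>) * (1 * ((1 - 1 / q) * weighted y q (k + 1)) + 1 * ((1 - q) * weighted y q (k + (- 1))))) =
      (\<lambda>k. toeplitz \<xi> (toeplitz \<xi> (y q)) k - weighted (\<lambda>q. toeplitz \<xi> (y q)) q k)"
    using q_ev
  proof eventually_elim
    case (elim q)
    have pw: "q powi (N q + (k + 1)) = q * q powi (N q + k)"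
      "q powi (N q + (k - 1)) = q powi (N q + k) / q"
      "q powi (N q + (k + - 1)) = q powi (N q + k) / q" for k
      using elim power_int_add[of q "N q + k" 1] power_int_diff[of q "N q + k" 1]
      by (simp_all add: add.assoc diff_add_eq add_diff_eq mult.commute)
    show ?case
      unfolding fun_eq_iff toeplitz_def weighted_def pw using elim
      by (simp add: field_simps)
  qed
  from negligible_family_cong[OF this n] show ?thesis
    using assms bounded_family_toeplitz by (simp add: asymptotic_eigenfamily_def)
qed

lemma asymptotic_eigenfamily_poly:
  assumes "asymptotic_eigenfamily y"
  shows "asymptotic_eigenfamily (\<lambda>q. poly_toeplitz \<xi> p (y q))"
proof (induction p)
  case 0
  show ?case using asymptotic_eigenfamily_lincomb[OF assms assms, of 0 0] by simp
next
  case (pCons a p)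
  show ?case
    using asymptotic_eigenfamily_lincomb[OF assms asymptotic_eigenfamily_toeplitz[OF pCons.IH], of a 1] by simp
qed

lemma ip_negligible:
  assumes "negligible_family y" "bounded_family z"
  shows "((\<lambda>q. ip D (y q) (z q)) \<longlongrightarrow> 0) F"
proof -
  obtain B where B: "\<forall>\<^sub>F q in F. l2 (z q) \<and> ip UNIV (z q) (z q) \<le> B"
    using assms by (auto simp: bounded_family_def)
  have y: "\<forall>\<^sub>F q in F. l2 (y q)" "((\<lambda>q. ip UNIV (y q) (y q)) \<longlongrightarrow> 0) F"
    using assms by (auto simp: negligible_family_def)
  have "((\<lambda>q. (ip D (y q) (z q))\<^sup>2) \<longlongrightarrow> 0) F"
  proof (rule tendsto_sandwich[where f = "\<lambda>_. 0"])
    show "\<forall>\<^sub>F q in F. (ip D (y q) (z q))\<^sup>2 \<le> ip UNIV (y q) (y q) * B"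
      using B y(1)
    proof eventually_elim
      case (elim q)
      have "(ip D (y q) (z q))\<^sup>2 \<le> ip UNIV (y q) (y q) * ip UNIV (z q) (z q)"
        using elim by (intro ip_cauchy_schwarz) auto
      also have "\<dots> \<le> ip UNIV (y q) (y q) * B"
        using elim by (intro mult_left_mono ip_self_nonneg) auto
      finally show ?case .
    qed
    show "((\<lambda>q. ip UNIV (y q) (y q) * B) \<longlongrightarrow> 0) F"
      using tendsto_mult[OF y(2) tendsto_const[of B]] by simp
  qed auto
  then have "((\<lambda>q. sqrt ((ip D (y q) (z q))\<^sup>2)) \<longlongrightarrow> sqrt 0) F"
    by (rule tendsto_real_sqrt)
  then show ?thesis by (simp add: tendsto_rabs_zero_iff)
qed

lemma bounded_family_l2: "bounded_family y \<Longrightarrow> \<forall>\<^sub>F q in F. l2 (y q)"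
  by (auto simp: bounded_family_def elim: eventually_mono)

text \<open>Multiplication by the weight is symmetric on every \<open>D\<close>, and
  \<open>A\<close> differs from it by negligible families. This is the form in which
  \<open>A\<close> commutes asymptotically with the restriction to \<open>D\<close>.\<close>

lemma toeplitz_asymp_symmetric:
  assumes "asymptotic_eigenfamily y" "asymptotic_eigenfamily z"
  shows "((\<lambda>q. ip D (toeplitz \<xi> (y q)) (z q) - ip D (y q) (toeplitz \<xi> (z q))) \<longlongrightarrow> 0) F"
proof -
  let ?e = "\<lambda>y q k. toeplitz \<xi> (y q) k - weighted y q k"
  have b: "bounded_family y" "bounded_family z"
    and n: "negligible_family (?e y)" "negligible_family (?e z)"
    using assms by (auto simp: asymptotic_eigenfamily_def)
  have "((\<lambda>q. ip D (?e y q) (z q) - ip D (?e z q) (y q)) \<longlongrightarrow> 0 - 0) F"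
    by (intro tendsto_diff ip_negligible n b)
  moreover have "\<forall>\<^sub>F q in F. ip D (?e y q) (z q) - ip D (?e z q) (y q) =
      ip D (toeplitz \<xi> (y q)) (z q) - ip D (y q) (toeplitz \<xi> (z q))"
    using bounded_family_l2[OF b(1)] bounded_family_l2[OF b(2)]
      bounded_family_l2[OF bounded_family_weighted[OF assms(1)]]
      bounded_family_l2[OF bounded_family_weighted[OF assms(2)]]
  proof eventually_elim
    case (elim q)
    have "ip D (\<lambda>k. 1 * toeplitz \<xi> (y q) k + (- 1) * weighted y q k) (z q) =
        1 * ip D (toeplitz \<xi> (y q)) (z q) + (- 1) * ip D (weighted y q) (z q)"
      "ip D (\<lambda>k. 1 * toeplitz \<xi> (z q) k + (- 1) * weighted z q k) (y q) =
        1 * ip D (toeplitz \<xi> (z q)) (y q) + (- 1) * ip D (weighted z q) (y q)"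
      using elim by (intro ip_lincomb_left l2_toeplitz; simp)+
    moreover have "ip D (weighted y q) (z q) = ip D (weighted z q) (y q)"
      by (simp add: ip_def weighted_def mult_ac)
    ultimately show ?case by (simp add: ip_commute[of D "y q"])
  qed
  ultimately show ?thesis using Lim_transform_eventually by fastforce
qed

text \<open>The factors \<open>A\<close> are moved across one at a time, every intermediate vector
  being again an asymptotic eigenfamily. The induction varies \<open>z\<close>, which collects the
  moved factors.\<close>

lemma poly_toeplitz_asymp_symmetric:
  assumes "asymptotic_eigenfamily y" "asymptotic_eigenfamily z"
  shows "((\<lambda>q. ip D (poly_toeplitz \<xi> p (y q)) (z q) - ip D (y q) (poly_toeplitz \<xi> p (z q))) \<longlongrightarrow> 0) F"
  using assms(2)
proof (induction p arbitrary: z)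
  case 0
  then show ?case by (simp add: ip_def)
next
  case (pCons a p)
  let ?P = "poly_toeplitz \<xi> p"
  have "((\<lambda>q. (ip D (toeplitz \<xi> (?P (y q))) (z q) - ip D (?P (y q)) (toeplitz \<xi> (z q))) +
      (ip D (?P (y q)) (toeplitz \<xi> (z q)) - ip D (y q) (?P (toeplitz \<xi> (z q))))) \<longlongrightarrow> 0 + 0) F"
    using assms(1) pCons.prems
    by (intro tendsto_add toeplitz_asymp_symmetric pCons.IH asymptotic_eigenfamily_poly
        asymptotic_eigenfamily_toeplitz)
  moreover have "\<forall>\<^sub>F q in F. (ip D (toeplitz \<xi> (?P (y q))) (z q) - ip D (?P (y q)) (toeplitz \<xi> (z q))) +
      (ip D (?P (y q)) (toeplitz \<xi> (z q)) - ip D (y q) (?P (toeplitz \<xi> (z q)))) =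
      ip D (poly_toeplitz \<xi> (pCons a p) (y q)) (z q) - ip D (y q) (poly_toeplitz \<xi> (pCons a p) (z q))"
  proof -
    have "\<forall>\<^sub>F q in F. l2 (y q)" "\<forall>\<^sub>F q in F. l2 (z q)"
      using assms(1) pCons.prems by (auto simp: asymptotic_eigenfamily_def intro: bounded_family_l2)
    then show ?thesis
    proof eventually_elim
      case (elim q)
      have "ip D (\<lambda>k. a * y q k + 1 * toeplitz \<xi> (?P (y q)) k) (z q) =
          a * ip D (y q) (z q) + 1 * ip D (toeplitz \<xi> (?P (y q))) (z q)"
        "ip D (y q) (\<lambda>k. a * z q k + 1 * toeplitz \<xi> (?P (z q)) k) =
          a * ip D (y q) (z q) + 1 * ip D (y q) (toeplitz \<xi> (?P (z q)))"
        using elim by (intro ip_lincomb_left ip_lincomb_right l2_toeplitz l2_poly_toeplitz; simp)+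
      then show ?case by (simp add: toeplitz_poly_toeplitz)
    qed
  qed
  ultimately show ?case using Lim_transform_eventually by fastforce
qed

text \<open>On the half line \<open>D\<close> the operator is asymptotically bounded by \<open>\<alpha>\<close>, from above or from below
  according to the sign \<open>s\<close>, since there it acts as multiplication by \<open>q\<^sup>N\<^sup>+\<^sup>k\<close>.\<close>

lemma half_line_bound:
  assumes y: "asymptotic_eigenfamily y"
    and D: "\<And>q k. 0 < q \<Longrightarrow> q < 1 \<Longrightarrow> k \<in> D \<Longrightarrow> s * q powi k \<le> s" and "e > 0"
  shows "\<forall>\<^sub>F q in F. s * (ip D (toeplitz \<xi> (y q)) (y q) - \<alpha> * ip D (y q) (y q)) < e"
proof -
  let ?e = "\<lambda>q k. toeplitz \<xi> (y q) k - weighted y q k"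
  have b: "bounded_family y" and n: "negligible_family ?e"
    using y by (auto simp: asymptotic_eigenfamily_def)
  obtain B where B: "\<forall>\<^sub>F q in F. l2 (y q) \<and> ip UNIV (y q) (y q) \<le> B"
    using b by (auto simp: bounded_family_def)
  have "((\<lambda>q. s * ip D (?e q) (y q) + \<bar>s\<bar> * \<bar>q powi N q - \<alpha>\<bar> * \<bar>B\<bar>) \<longlongrightarrow> s * 0 + \<bar>s\<bar> * \<bar>\<alpha> - \<alpha>\<bar> * \<bar>B\<bar>) F"
    by (intro tendsto_intros ip_negligible n b qN_lim)
  then have "\<forall>\<^sub>F q in F. s * ip D (?e q) (y q) + \<bar>s\<bar> * \<bar>q powi N q - \<alpha>\<bar> * \<bar>B\<bar> < e"
    using \<open>e > 0\<close> by (auto intro: order_tendstoD)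
  then show ?thesis
    using B q_ev bounded_family_l2[OF bounded_family_weighted[OF y]]
  proof eventually_elim
    case (elim q)
    have l: "l2 (y q)" "l2 (weighted y q)" "l2 (toeplitz \<xi> (y q))" using elim by (auto intro: l2_toeplitz)
    have 1: "ip D (\<lambda>k. 1 * toeplitz \<xi> (y q) k + (- 1) * weighted y q k) (y q) =
        1 * ip D (toeplitz \<xi> (y q)) (y q) + (- 1) * ip D (weighted y q) (y q)"
      by (intro ip_lincomb_left l)
    have "s * ip D (weighted y q) (y q) = (\<Sum>\<^sub>\<infinity>k\<in>D. s * (weighted y q k * y q k))"
      by (simp add: ip_def infsum_cmult_right')
    also have "\<dots> \<le> (\<Sum>\<^sub>\<infinity>k\<in>D. s * q powi N q * (y q k * y q k))"
    proof (rule infsum_mono)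
      show "(\<lambda>k. s * (weighted y q k * y q k)) summable_on D"
        "(\<lambda>k. s * q powi N q * (y q k * y q k)) summable_on D"
        using l by (auto intro!: summable_on_cmult_right l2_mult_summable)
      fix k assume k: "k \<in> D"
      have "s * q powi k * (q powi N q * (y q k * y q k)) \<le> s * (q powi N q * (y q k * y q k))"
        using elim k by (intro mult_right_mono D) auto
      then show "s * (weighted y q k * y q k) \<le> s * q powi N q * (y q k * y q k)"
        using elim by (simp add: weighted_def power_int_add mult_ac)
    qed
    also have "\<dots> = s * q powi N q * ip D (y q) (y q)"
      by (simp add: ip_def infsum_cmult_right')
    finally have 2: "s * ip D (weighted y q) (y q) \<le> s * q powi N q * ip D (y q) (y q)" .
    have "s * (q powi N q - \<alpha>) * ip D (y q) (y q) \<le> \<bar>s\<bar> * \<bar>q powi N q - \<alpha>\<bar> * \<bar>B\<bar>"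
    proof (rule mult_mono)
      show "s * (q powi N q - \<alpha>) \<le> \<bar>s\<bar> * \<bar>q powi N q - \<alpha>\<bar>"
        by (simp flip: abs_mult)
      show "ip D (y q) (y q) \<le> \<bar>B\<bar>"
        using ip_self_mono[OF l(1), of D] elim by linarith
    qed (auto simp: ip_self_nonneg)
    moreover have "s * (ip D (toeplitz \<xi> (y q)) (y q) - \<alpha> * ip D (y q) (y q)) =
        s * ip D (?e q) (y q) + s * ip D (weighted y q) (y q) - s * \<alpha> * ip D (y q) (y q)"
      using 1 by (simp add: algebra_simps flip: distrib_left)
    moreover have "s * (q powi N q - \<alpha>) * ip D (y q) (y q) =
        s * q powi N q * ip D (y q) (y q) - s * \<alpha> * ip D (y q) (y q)"
      by (simp add: algebra_simps)
    ultimately show ?case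
      using 2 elim by linarith
  qed
qed

end

subsection \<open>Polynomial cutoffs\<close>

lemma weierstrass_poly:
  fixes f :: "real \<Rightarrow> real"
  assumes "continuous_on {a..b} f" "e > 0"
  obtains p :: "real poly" where "\<And>x. x \<in> {a..b} \<Longrightarrow> \<bar>f x - poly p x\<bar> < e"
proof -
  obtain g where g: "real_polynomial_function g" "\<And>x. x \<in> {a..b} \<Longrightarrow> \<bar>f x - g x\<bar> < e"
    using Stone_Weierstrass_real_polynomial_function[OF _ assms] by auto
  obtain c n where c: "g = (\<lambda>x. \<Sum>i\<le>n. c i * x ^ i)"
    using g(1) by (auto simp: real_polynomial_function_iff_sum)
  have "poly (\<Sum>i\<le>n. monom (c i) i) x = g x" for x
    by (simp add: c poly_sum poly_monom)
  then show thesis using that g(2) by metis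
qed

text \<open>For positive \<eta> this is 1 up to \<eta> and 0 from \<open>2 * \<eta>\<close> on. The
  plateau extends beyond 0 so that \<open>1 - cutoff \<eta> t\<close> vanishes near
  \<open>t = 0\<close> and stays continuous after division by \<open>t\<close>.\<close>

definition cutoff :: "real \<Rightarrow> real \<Rightarrow> real" where
  "cutoff \<eta> t = max 0 (min 1 (2 - t / \<eta>))"

lemma abs_square_diff_le:
  fixes a b :: real
  assumes "\<bar>a - b\<bar> \<le> e" "e \<le> 1" "0 \<le> a" "a \<le> R"
  shows "\<bar>a\<^sup>2 - b\<^sup>2\<bar> \<le> e * (2 * R + 1)"
proof -
  have "\<bar>a\<^sup>2 - b\<^sup>2\<bar> = \<bar>a - b\<bar> * \<bar>a + b\<bar>"
    by (simp add: power2_eq_square algebra_simps flip: abs_mult)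
  also have "\<dots> \<le> e * (2 * R + 1)"
    using assms by (intro mult_mono) auto
  finally show ?thesis .
qed

text \<open>A polynomial partition of unity \<open>s (x - \<alpha>) \<rho>\<^sup>2 + \<sigma>\<^sup>2 \<approx> 1\<close> in which \<open>\<sigma>\<^sup>2\<close> approximates the
  indicator function of \<open>s (x - \<alpha>) \<le> 0\<close>.\<close>

lemma cutoff_polys:
  fixes \<alpha> s \<eta> \<delta> :: real
  assumes "\<eta> > 0" "\<delta> > 0"
  obtains \<rho> \<sigma> :: "real poly"
  where "\<And>x. x \<in> {0..4} \<Longrightarrow> \<bar>1 - s * (x - \<alpha>) * (poly \<rho> x)\<^sup>2 - (poly \<sigma> x)\<^sup>2\<bar> \<le> \<delta>"
    and "\<And>x. x \<in> {0..4} \<Longrightarrow> \<bar>cutoff \<eta> (s * (x - \<alpha>)) - (poly \<sigma> x)\<^sup>2\<bar> \<le> \<delta>"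
proof -
  define t where "t = (\<lambda>x. s * (x - \<alpha>))"
  define h where "h = (\<lambda>x. cutoff \<eta> (t x))"
  \<comment> \<open>In effect the quotient \<open>(1 - h x) / t x\<close>: where
    \<open>t x < \<eta>\<close> the numerator is 0, so the maximum only removes the division by
    zero.\<close>
  define f where "f = (\<lambda>x. (1 - h x) / max (t x) \<eta>)"
  define C where "C = \<bar>s\<bar> * (4 + \<bar>\<alpha>\<bar>)"
  define R where "R = 1 + 1 / \<eta>"
  \<comment> \<open>\<open>C\<close> bounds the modulus of \<open>t\<close> on \<open>{0..4}\<close>
    and \<open>R\<close> bounds \<open>sqrt (f x)\<close>. Squaring the approximations costs
    \<open>e * (2 * R + 1)\<close> for \<rho> and \<open>3 * e\<close> for \<sigma>; the choice of
    \<open>e\<close> keeps \<open>C\<close> times the first plus the second below \<delta>.\<close>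
  define e where "e = min 1 (\<delta> / (C * (2 * R + 1) + 3))"
  have C: "C \<ge> 0" and R: "R \<ge> 1" using assms by (auto simp: C_def R_def)
  then have den: "C * (2 * R + 1) + 3 > 0" by (intro add_nonneg_pos mult_nonneg_nonneg) auto
  have e: "e > 0" "e \<le> 1" using den assms by (auto simp: e_def)
  have "e * (C * (2 * R + 1) + 3) \<le> \<delta>"
  proof -
    have "e * (C * (2 * R + 1) + 3) \<le> \<delta> / (C * (2 * R + 1) + 3) * (C * (2 * R + 1) + 3)"
      using den by (intro mult_right_mono) (auto simp: e_def)
    then show ?thesis using den by simp
  qed
  moreover have "0 \<le> e * (C * (2 * R + 1))" using C R e by auto
  ultimately have e\<delta>: "e * (C * (2 * R + 1)) + 3 * e \<le> \<delta>" "3 * e \<le> \<delta>"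
    by (simp_all add: algebra_simps)
  have h01: "0 \<le> h x" "h x \<le> 1" for x
    by (auto simp: h_def cutoff_def)
  have f0: "0 \<le> f x" for x using h01[of x] assms by (auto simp: f_def)
  have "f x \<le> 1 / \<eta>" for x
    unfolding f_def using h01[of x] assms by (intro frac_le) auto
  then have fR: "sqrt (f x) \<le> R" for x
  proof -
    have "f x \<le> R" using \<open>f x \<le> 1 / \<eta>\<close> by (simp add: R_def)
    also have "R \<le> R\<^sup>2" using R by (simp add: power2_eq_square)
    finally show ?thesis using R by (intro real_le_lsqrt) auto
  qed
  have id: "t x * f x + h x = 1" for x
  proof (cases "t x \<ge> \<eta>")
    case True
    then show ?thesis using assms by (simp add: f_def max_def)
  next
    case False
    then have "t x / \<eta> \<le> 1" using assms by (simp add: field_simps)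
    then have "h x = 1" by (simp add: h_def cutoff_def)
    then show ?thesis by (simp add: f_def)
  qed
  have ch: "continuous_on {0..4} h"
    unfolding h_def cutoff_def t_def using assms by (intro continuous_intros) auto
  \<comment> \<open>Square roots are approximated, so that the polynomials occur in the partition as
    squares.\<close>
  have "continuous_on {0..4} (\<lambda>x. sqrt (f x))"
    unfolding f_def t_def using assms by (intro continuous_intros ch) auto
  from weierstrass_poly[OF this e(1)] obtain \<rho> where \<rho>: "\<And>x. x \<in> {0..4} \<Longrightarrow> \<bar>sqrt (f x) - poly \<rho> x\<bar> < e"
    by blast
  have "continuous_on {0..4} (\<lambda>x. sqrt (h x))"
    by (intro continuous_intros ch)
  from weierstrass_poly[OF this e(1)] obtain \<sigma> where \<sigma>: "\<And>x. x \<in> {0..4} \<Longrightarrow> \<bar>sqrt (h x) - poly \<sigma> x\<bar> < e"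
    by blast
  have \<sigma>2: "\<bar>h x - (poly \<sigma> x)\<^sup>2\<bar> \<le> 3 * e" if "x \<in> {0..4}" for x
    using abs_square_diff_le[of "sqrt (h x)" "poly \<sigma> x" e 1] \<sigma>[OF that] e h01[of x] by simp
  show thesis
  proof (rule that)
    fix x :: real assume x: "x \<in> {0..4}"
    have "\<bar>t x * (f x - (poly \<rho> x)\<^sup>2)\<bar> \<le> C * (e * (2 * R + 1))"
      unfolding abs_mult
    proof (rule mult_mono)
      show "\<bar>t x\<bar> \<le> C"
        unfolding t_def C_def abs_mult using x by (intro mult_left_mono) auto
      show "\<bar>f x - (poly \<rho> x)\<^sup>2\<bar> \<le> e * (2 * R + 1)"
        using abs_square_diff_le[of "sqrt (f x)" "poly \<rho> x" e R] \<rho>[OF x] e f0[of x] fR[of x] by simp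
    qed (use C in auto)
    moreover have "1 - s * (x - \<alpha>) * (poly \<rho> x)\<^sup>2 - (poly \<sigma> x)\<^sup>2 =
        t x * (f x - (poly \<rho> x)\<^sup>2) + (h x - (poly \<sigma> x)\<^sup>2)"
      using id[of x] by (simp add: t_def algebra_simps)
    ultimately show "\<bar>1 - s * (x - \<alpha>) * (poly \<rho> x)\<^sup>2 - (poly \<sigma> x)\<^sup>2\<bar> \<le> \<delta>"
      using \<sigma>2[OF x] e\<delta>(1) by (simp add: mult_ac)
    show "\<bar>cutoff \<eta> (s * (x - \<alpha>)) - (poly \<sigma> x)\<^sup>2\<bar> \<le> \<delta>"
      using \<sigma>2[OF x] e\<delta>(2) by (simp add: h_def t_def)
  qed
qed

lemma cutoff_LIMSEQ: "(\<lambda>n. cutoff (1 / real (Suc n)) t) \<longlonglongrightarrow> (if t \<le> 0 then 1 else 0)"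
proof (cases "t \<le> 0")
  case True
  then have "t * real (Suc n) \<le> 0" for n by (intro mult_nonpos_nonneg) auto
  then have "cutoff (1 / real (Suc n)) t = 1" for n
    unfolding cutoff_def by (smt (verit) divide_divide_eq_right div_by_1)
  then show ?thesis using True by simp
next
  case False
  obtain m where m: "2 / t < real m" using reals_Archimedean2 by blast
  have "cutoff (1 / real (Suc n)) t = 0" if "n \<ge> m" for n
  proof -
    have "2 / t < real (Suc n)" using m that by simp
    then have "2 < t * real (Suc n)" using False by (simp add: field_simps)
    then show ?thesis by (simp add: cutoff_def)
  qed
  then have "\<forall>\<^sub>F n in sequentially. cutoff (1 / real (Suc n)) t = 0"
    by (auto simp: eventually_sequentially)
  then show ?thesis using False by (simp add: tendsto_eventually)
qed

subsection \<open>Convergence to the spectral projection\<close>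

context bulk_limit
begin

lemma symbol_range: "symbol \<xi> \<theta> \<in> {0..4}"
proof -
  have c: "\<xi> * cos \<theta> \<le> \<xi>" "- \<xi> \<le> \<xi> * cos \<theta>"
    using xi mult_left_mono[OF cos_le_one[of \<theta>], of \<xi>] mult_left_mono[OF cos_ge_minus_one[of \<theta>], of \<xi>] by auto
  have "0 \<le> (1 - \<xi>)\<^sup>2" "(1 + \<xi>)\<^sup>2 \<le> 2\<^sup>2"
    using xi power_mono[of "1 + \<xi>" 2 2] by simp_all
  then show ?thesis using c by (simp add: symbol_def power2_eq_square algebra_simps)
qed

lemma continuous_symbol [continuous_intros]: "continuous_on S (symbol \<xi>)"
  unfolding symbol_def by (intro continuous_intros)

text \<open>Split \<open>y\<close> as \<open>r(A) y + s \<rho>(A) (A - \<alpha>) \<rho>(A) y +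
  \<sigma>(A) \<sigma>(A) y\<close> and pair with \<open>y\<close> on \<open>D\<close>. The first
  term is small by Cauchy-Schwarz, since \<open>r\<close> is at most \<delta> in modulus on the
  range of the symbol. In the second, one factor \<open>\<rho>(A)\<close> is moved across, and
  \<open>half_line_bound\<close> shows that the term is at most o(1). The third becomes a squared
  norm on \<open>D\<close>, bounded by the full norm, which is an integral.\<close>

lemma half_line_upper_bound:
  assumes y: "asymptotic_eigenfamily y"
    and D: "\<And>q k. 0 < q \<Longrightarrow> q < 1 \<Longrightarrow> k \<in> D \<Longrightarrow> s * q powi k \<le> s"
    and spec: "\<And>p. \<forall>\<^sub>F q in F. ((\<lambda>\<theta>. poly p (symbol \<xi> \<theta>) * w \<theta>) has_integral
      pi * ip UNIV (poly_toeplitz \<xi> p (y q)) (y q)) {0..pi}"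
    and w: "\<And>\<theta>. 0 \<le> w \<theta>" "continuous_on {0..pi} w"
    and part: "\<And>\<theta>. \<bar>1 - s * (symbol \<xi> \<theta> - \<alpha>) * (poly \<rho> (symbol \<xi> \<theta>))\<^sup>2 - (poly \<sigma> (symbol \<xi> \<theta>))\<^sup>2\<bar> \<le> \<delta>"
    and "e > 0"
  shows "\<forall>\<^sub>F q in F. pi * ip D (y q) (y q) <
    \<delta> * integral {0..pi} w + integral {0..pi} (\<lambda>\<theta>. (poly \<sigma> (symbol \<xi> \<theta>))\<^sup>2 * w \<theta>) + e"
proof -
  define X where "X = [:- \<alpha>, 1:]"
  define r where "r = 1 - smult s (\<rho> * (X * \<rho>)) - \<sigma> * \<sigma>"
  define I where "I = integral {0..pi} (\<lambda>\<theta>. (poly \<sigma> (symbol \<xi> \<theta>))\<^sup>2 * w \<theta>)"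
  let ?T = "poly_toeplitz \<xi>"
  have poly_r: "poly r x = 1 - s * (x - \<alpha>) * (poly \<rho> x)\<^sup>2 - (poly \<sigma> x)\<^sup>2" for x
    by (simp add: r_def X_def power2_eq_square algebra_simps)
  have \<delta>: "\<delta> \<ge> 0" using part[of 0] abs_ge_zero order_trans by blast
  have W0: "integral {0..pi} w \<ge> 0"
    by (intro integral_nonneg integrable_continuous_interval w)
  \<comment> \<open>Three asymptotic estimates enter: moving \<rho> across, the sign on
    \<open>D\<close>, and moving \<sigma> across. Each costs \<open>e / (4 * pi)\<close>, which
    after multiplication by \<open>pi\<close> leaves a total below \<open>e\<close>.\<close>
  have e': "e / (4 * pi) > 0" using \<open>e > 0\<close> by simp
  have T1: "?T 1 z = z" for z by (simp add: one_pCons)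
  have TX: "?T (X * p) z = (\<lambda>k. toeplitz \<xi> (?T p z) k - \<alpha> * ?T p z k)" for p z
    by (simp only: X_def poly_toeplitz_mult) simp
  have dec: "z = (\<lambda>k. 1 * (1 * ?T r z k + s * ?T \<rho> (?T (X * \<rho>) z) k) + 1 * ?T \<sigma> (?T \<sigma> z) k)" for z
  proof -
    have one: "1 = r + smult s (\<rho> * (X * \<rho>)) + \<sigma> * \<sigma>" by (simp add: r_def)
    have "?T 1 z = (\<lambda>k. ?T r z k + s * ?T (\<rho> * (X * \<rho>)) z k + ?T (\<sigma> * \<sigma>) z k)"
      by (subst one) (simp only: poly_toeplitz_add poly_toeplitz_smult)
    then show ?thesis by (simp add: T1 poly_toeplitz_mult)
  qed
  have "((\<lambda>q. ip D (?T \<rho> (?T (X * \<rho>) (y q))) (y q) - ip D (?T (X * \<rho>) (y q)) (?T \<rho> (y q))) \<longlongrightarrow> 0) F"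
    by (intro poly_toeplitz_asymp_symmetric asymptotic_eigenfamily_poly y)
  then have "((\<lambda>q. s * (ip D (?T \<rho> (?T (X * \<rho>) (y q))) (y q) - ip D (?T (X * \<rho>) (y q)) (?T \<rho> (y q)))) \<longlongrightarrow> s * 0) F"
    by (intro tendsto_mult tendsto_const)
  then have ev1: "\<forall>\<^sub>F q in F. s * (ip D (?T \<rho> (?T (X * \<rho>) (y q))) (y q) -
      ip D (?T (X * \<rho>) (y q)) (?T \<rho> (y q))) < e / (4 * pi)"
    using e' by (auto intro: order_tendstoD)
  have ev2: "\<forall>\<^sub>F q in F. s * (ip D (toeplitz \<xi> (?T \<rho> (y q))) (?T \<rho> (y q)) - \<alpha> * ip D (?T \<rho> (y q)) (?T \<rho> (y q))) < e / (4 * pi)"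
    by (intro half_line_bound asymptotic_eigenfamily_poly y D e')
  have "((\<lambda>q. ip D (?T \<sigma> (?T \<sigma> (y q))) (y q) - ip D (?T \<sigma> (y q)) (?T \<sigma> (y q))) \<longlongrightarrow> 0) F"
    by (intro poly_toeplitz_asymp_symmetric asymptotic_eigenfamily_poly y)
  then have ev3: "\<forall>\<^sub>F q in F. ip D (?T \<sigma> (?T \<sigma> (y q))) (y q) - ip D (?T \<sigma> (y q)) (?T \<sigma> (y q)) < e / (4 * pi)"
    using e' by (auto intro: order_tendstoD)
  have l2: "\<forall>\<^sub>F q in F. l2 (y q)"
    using y by (auto simp: asymptotic_eigenfamily_def intro: bounded_family_l2)
  show ?thesis
    using ev1 ev2 ev3 l2 spec[of "r * r"] spec[of "\<sigma> * \<sigma>"] spec[of 1]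
  proof eventually_elim
    case (elim q)
    note l = \<open>l2 (y q)\<close>
    note lT = l2_poly_toeplitz[OF l] l2_poly_toeplitz[OF l2_poly_toeplitz[OF l]]
    have W: "pi * ip UNIV (y q) (y q) = integral {0..pi} w"
      using elim(7) by (simp add: T1 integral_unique)
    \<comment> \<open>By symmetry on the full line, \<open>spec\<close> for \<open>r * r\<close>
      turns the squared norm of \<open>r(A) y\<close> into an integral, where \<open>part\<close>
      applies pointwise.\<close>
    have "pi * ip UNIV (?T r (y q)) (?T r (y q)) \<le> \<delta>\<^sup>2 * integral {0..pi} w"
    proof -
      have "((\<lambda>\<theta>. (poly r (symbol \<xi> \<theta>))\<^sup>2 * w \<theta>) has_integral pi * ip UNIV (?T r (y q)) (?T r (y q))) {0..pi}"
        using elim(5) poly_toeplitz_symmetric[where y = "?T r (y q)" and z = "y q" and p = r and \<xi> = \<xi>, OF lT(1) l]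
        by (simp add: poly_toeplitz_mult power2_eq_square)
      moreover have "((\<lambda>\<theta>. \<delta>\<^sup>2 * w \<theta>) has_integral \<delta>\<^sup>2 * integral {0..pi} w) {0..pi}"
        by (intro has_integral_mult_right integrable_integral integrable_continuous_interval w)
      ultimately show ?thesis
      proof (rule has_integral_le)
        fix \<theta>
        have "(poly r (symbol \<xi> \<theta>))\<^sup>2 \<le> \<delta>\<^sup>2"
          using part[of \<theta>] \<delta> by (intro abs_le_square_iff[THEN iffD1]) (simp add: poly_r)
        then show "(poly r (symbol \<xi> \<theta>))\<^sup>2 * w \<theta> \<le> \<delta>\<^sup>2 * w \<theta>"
          by (intro mult_right_mono w)
      qed
    qed
    then have u: "(pi * ip UNIV (?T r (y q)) (?T r (y q))) * (pi * ip UNIV (y q) (y q)) \<le>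
        (\<delta>\<^sup>2 * integral {0..pi} w) * integral {0..pi} w"
      unfolding W by (intro mult_right_mono W0)
    have "(pi * ip D (?T r (y q)) (y q))\<^sup>2 = pi\<^sup>2 * (ip D (?T r (y q)) (y q))\<^sup>2"
      by (rule power_mult_distrib)
    also have "\<dots> \<le> pi\<^sup>2 * (ip UNIV (?T r (y q)) (?T r (y q)) * ip UNIV (y q) (y q))"
      by (intro mult_left_mono ip_cauchy_schwarz lT l) auto
    also have "\<dots> = (pi * ip UNIV (?T r (y q)) (?T r (y q))) * (pi * ip UNIV (y q) (y q))"
      by (simp add: power2_eq_square mult_ac)
    also note u
    also have "(\<delta>\<^sup>2 * integral {0..pi} w) * integral {0..pi} w = (\<delta> * integral {0..pi} w)\<^sup>2"
      by (simp add: power2_eq_square mult_ac)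
    finally have "(pi * ip D (?T r (y q)) (y q))\<^sup>2 \<le> (\<delta> * integral {0..pi} w)\<^sup>2" .
    then have r: "pi * ip D (?T r (y q)) (y q) \<le> \<delta> * integral {0..pi} w"
      using \<delta> W0 by (intro power2_le_imp_le[of "pi * ip D (?T r (y q)) (y q)"]) auto
    have "pi * ip UNIV (?T \<sigma> (y q)) (?T \<sigma> (y q)) = I"
      using elim(6) poly_toeplitz_symmetric[where y = "?T \<sigma> (y q)" and z = "y q" and p = \<sigma> and \<xi> = \<xi>, OF lT(1) l]
      by (simp add: I_def poly_toeplitz_mult power2_eq_square integral_unique)
    moreover have "pi * ip D (?T \<sigma> (y q)) (?T \<sigma> (y q)) \<le> pi * ip UNIV (?T \<sigma> (y q)) (?T \<sigma> (y q))"
      by (intro mult_left_mono ip_self_mono lT) auto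
    ultimately have \<sigma>: "pi * ip D (?T \<sigma> (y q)) (?T \<sigma> (y q)) \<le> I" by simp
    have "ip D (\<lambda>k. 1 * toeplitz \<xi> (?T \<rho> (y q)) k + (- \<alpha>) * ?T \<rho> (y q) k) (?T \<rho> (y q)) =
        1 * ip D (toeplitz \<xi> (?T \<rho> (y q))) (?T \<rho> (y q)) + (- \<alpha>) * ip D (?T \<rho> (y q)) (?T \<rho> (y q))"
      by (intro ip_lincomb_left l2_toeplitz lT)
    then have \<rho>: "s * ip D (?T (X * \<rho>) (y q)) (?T \<rho> (y q)) < e / (4 * pi)"
      using elim(2) by (simp add: TX)
    have "ip D (y q) (y q) = 1 * (1 * ip D (?T r (y q)) (y q) + s * ip D (?T \<rho> (?T (X * \<rho>) (y q))) (y q)) +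
        1 * ip D (?T \<sigma> (?T \<sigma> (y q))) (y q)"
      by (subst dec[of "y q"]) (simp only: ip_lincomb_left l2_lincomb lT l)
    also have "\<dots> < ip D (?T r (y q)) (y q) + ip D (?T \<sigma> (y q)) (?T \<sigma> (y q)) + 3 * (e / (4 * pi))"
      using elim(1,3) \<rho> by (simp add: algebra_simps)
    finally have "pi * ip D (y q) (y q) <
        pi * (ip D (?T r (y q)) (y q) + ip D (?T \<sigma> (y q)) (?T \<sigma> (y q)) + 3 * (e / (4 * pi)))"
      by (rule mult_strict_left_mono) simp
    also have "\<dots> = pi * ip D (?T r (y q)) (y q) + pi * ip D (?T \<sigma> (y q)) (?T \<sigma> (y q)) + 3 / 4 * e"
      by (simp add: field_simps)
    also have "\<dots> \<le> \<delta> * integral {0..pi} w + I + e"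
      using r \<sigma> \<open>e > 0\<close> by simp
    finally show ?case by (simp add: I_def)
  qed
qed

text \<open>The sharp indicator is approached from above by cutoffs. Their width is fixed first, by
  dominated convergence; then polynomials are chosen, whose accuracy \<delta> depends only on
  \<open>W\<close> and \<open>e\<close>.\<close>

lemma half_line_limsup:
  assumes y: "asymptotic_eigenfamily y"
    and D: "\<And>q k. 0 < q \<Longrightarrow> q < 1 \<Longrightarrow> k \<in> D \<Longrightarrow> s * q powi k \<le> s"
    and spec: "\<And>p. \<forall>\<^sub>F q in F. ((\<lambda>\<theta>. poly p (symbol \<xi> \<theta>) * w \<theta>) has_integral
      pi * ip UNIV (poly_toeplitz \<xi> p (y q)) (y q)) {0..pi}"
    and w: "\<And>\<theta>. 0 \<le> w \<theta>" "continuous_on {0..pi} w"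
    and "e > 0"
  shows "\<forall>\<^sub>F q in F. pi * ip D (y q) (y q) <
    integral {0..pi} (\<lambda>\<theta>. if s * (symbol \<xi> \<theta> - \<alpha>) \<le> 0 then w \<theta> else 0) + e"
proof -
  define W where "W = integral {0..pi} w"
  define L where "L = integral {0..pi} (\<lambda>\<theta>. if s * (symbol \<xi> \<theta> - \<alpha>) \<le> 0 then w \<theta> else 0)"
  define f where "f = (\<lambda>n \<theta>. cutoff (1 / real (Suc n)) (s * (symbol \<xi> \<theta> - \<alpha>)) * w \<theta>)"
  have W0: "W \<ge> 0"
    unfolding W_def by (intro integral_nonneg integrable_continuous_interval w)
  have cont: "continuous_on {0..pi} (f n)" for n
    unfolding f_def cutoff_def by (intro continuous_intros w) simp_all
  have "(\<lambda>n. integral {0..pi} (f n)) \<longlonglongrightarrow> L"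
    unfolding L_def
  proof (rule dominated_convergence(2)[where h = w])
    show "f n integrable_on {0..pi}" for n
      by (intro integrable_continuous_interval cont)
    show "w integrable_on {0..pi}"
      by (intro integrable_continuous_interval w)
    show "norm (f n \<theta>) \<le> w \<theta>" for n \<theta>
      unfolding f_def using w(1)[of \<theta>]
      by (auto simp: abs_mult cutoff_def intro!: mult_left_le_one_le)
    show "(\<lambda>n. f n \<theta>) \<longlonglongrightarrow> (if s * (symbol \<xi> \<theta> - \<alpha>) \<le> 0 then w \<theta> else 0)" for \<theta>
      using tendsto_mult_right[OF cutoff_LIMSEQ, of "s * (symbol \<xi> \<theta> - \<alpha>)" "w \<theta>"]
      by (cases "s * (symbol \<xi> \<theta> - \<alpha>) \<le> 0") (simp_all add: f_def)
  qed
  then have "\<forall>\<^sub>F n in sequentially. integral {0..pi} (f n) < L + e / 3"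
    using \<open>e > 0\<close> by (intro order_tendstoD) auto
  then obtain n where n: "integral {0..pi} (f n) < L + e / 3"
    by (auto simp: eventually_sequentially)
  \<comment> \<open>An error \<open>\<delta> * W\<close> occurs twice, from the partition of unity
    and from replacing the cutoff by the square of \<sigma>; \<open>W + 1\<close> keeps the
    denominator positive when \<open>W = 0\<close>.\<close>
  define \<delta> where "\<delta> = e / (6 * (W + 1))"
  have \<delta>: "\<delta> > 0" "2 * \<delta> * W \<le> e / 3"
    using \<open>e > 0\<close> W0 by (auto simp: \<delta>_def field_simps)
  obtain \<rho> \<sigma> where
    part: "\<And>x. x \<in> {0..4} \<Longrightarrow> \<bar>1 - s * (x - \<alpha>) * (poly \<rho> x)\<^sup>2 - (poly \<sigma> x)\<^sup>2\<bar> \<le> \<delta>"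
    and \<sigma>: "\<And>x. x \<in> {0..4} \<Longrightarrow> \<bar>cutoff (1 / real (Suc n)) (s * (x - \<alpha>)) - (poly \<sigma> x)\<^sup>2\<bar> \<le> \<delta>"
    using cutoff_polys[of "1 / real (Suc n)" \<delta> s \<alpha>] \<delta> by (metis divide_pos_pos of_nat_0_less_iff zero_less_Suc zero_less_one)
  have "integral {0..pi} (\<lambda>\<theta>. (poly \<sigma> (symbol \<xi> \<theta>))\<^sup>2 * w \<theta>) \<le> integral {0..pi} (\<lambda>\<theta>. f n \<theta> + \<delta> * w \<theta>)"
  proof (rule integral_le)
    show "(\<lambda>\<theta>. (poly \<sigma> (symbol \<xi> \<theta>))\<^sup>2 * w \<theta>) integrable_on {0..pi}"
      "(\<lambda>\<theta>. f n \<theta> + \<delta> * w \<theta>) integrable_on {0..pi}"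
      by (intro integrable_continuous_interval continuous_intros w cont)+
    fix \<theta>
    have "(poly \<sigma> (symbol \<xi> \<theta>))\<^sup>2 \<le> cutoff (1 / real (Suc n)) (s * (symbol \<xi> \<theta> - \<alpha>)) + \<delta>"
      using \<sigma>[OF symbol_range, of \<theta>] by linarith
    from mult_right_mono[OF this w(1)[of \<theta>]] show "(poly \<sigma> (symbol \<xi> \<theta>))\<^sup>2 * w \<theta> \<le> f n \<theta> + \<delta> * w \<theta>"
      by (simp add: f_def algebra_simps)
  qed
  also have "\<dots> = integral {0..pi} (f n) + \<delta> * W"
    unfolding W_def
    by (subst Henstock_Kurzweil_Integration.integral_add)
      (auto intro!: integrable_continuous_interval continuous_intros w cont)
  finally have I: "integral {0..pi} (\<lambda>\<theta>. (poly \<sigma> (symbol \<xi> \<theta>))\<^sup>2 * w \<theta>) \<le> integral {0..pi} (f n) + \<delta> * W" .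
  have "\<forall>\<^sub>F q in F. pi * ip D (y q) (y q) <
      \<delta> * W + integral {0..pi} (\<lambda>\<theta>. (poly \<sigma> (symbol \<xi> \<theta>))\<^sup>2 * w \<theta>) + e / 3"
    unfolding W_def
    by (rule half_line_upper_bound[OF y D spec w]) (use part symbol_range \<open>e > 0\<close> in auto)
  then show ?thesis
  proof eventually_elim
    case (elim q)
    then show ?case using I n \<delta>(2) unfolding L_def by linarith
  qed
qed

text \<open>With \<open>s = 1\<close> on \<open>{1..}\<close> and \<open>s = - 1\<close> on its
  complement, \<open>half_line_limsup\<close> bounds both masses from above. The masses add up to
  the integral of \<open>w\<close> over \<open>{0..pi}\<close> divided by \<open>pi\<close>, and the
  bounds match this, because the closed level regions overlap only in
  \<open>arccos \<kappa>\<close>. Hence the bound on the complement is also a lower bound on the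
  half line.\<close>

lemma half_line_tendsto:
  assumes y: "asymptotic_eigenfamily y"
    and spec: "\<And>p. \<forall>\<^sub>F q in F. ((\<lambda>\<theta>. poly p (symbol \<xi> \<theta>) * w \<theta>) has_integral
      pi * ip UNIV (poly_toeplitz \<xi> p (y q)) (y q)) {0..pi}"
    and w: "\<And>\<theta>. 0 \<le> w \<theta>" "continuous_on {0..pi} w"
    and \<kappa>: "\<kappa> = (1 + \<xi>\<^sup>2 - \<alpha>) / (2 * \<xi>)" "- 1 \<le> \<kappa>" "\<kappa> \<le> 1"
  shows "((\<lambda>q. pi * ip {1..} (y q) (y q)) \<longlongrightarrow> integral {0..arccos \<kappa>} w) F"
proof -
  let ?t = "arccos \<kappa>"
  have t: "0 \<le> ?t" "?t \<le> pi" "cos ?t = \<kappa>" using \<kappa> by (auto simp: arccos_lbound arccos_ubound)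
  \<comment> \<open>\<kappa> is the cosine of the angle at which the symbol, increasing on
    \<open>{0..pi}\<close>, crosses \<alpha>.\<close>
  have sym: "symbol \<xi> \<theta> - \<alpha> = 2 * \<xi> * (\<kappa> - cos \<theta>)" for \<theta>
    using xi by (simp add: symbol_def \<kappa>(1) field_simps)
  have le: "symbol \<xi> \<theta> - \<alpha> \<le> 0 \<longleftrightarrow> \<theta> \<le> ?t" "symbol \<xi> \<theta> - \<alpha> \<ge> 0 \<longleftrightarrow> ?t \<le> \<theta>" if "\<theta> \<in> {0..pi}" for \<theta>
    unfolding sym using that t xi cos_mono_le_eq[of \<theta> ?t] cos_mono_le_eq[of ?t \<theta>]
    by (auto simp: mult_le_0_iff zero_le_mult_iff)
  have "integral {0..pi} (\<lambda>\<theta>. if 1 * (symbol \<xi> \<theta> - \<alpha>) \<le> 0 then w \<theta> else 0) =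
      integral {0..pi} (\<lambda>\<theta>. if \<theta> \<in> {0..?t} then w \<theta> else 0)"
    by (rule Henstock_Kurzweil_Integration.integral_cong) (use le in auto)
  also have "\<dots> = integral {0..?t} w"
    unfolding integral_restrict_Int by (rule arg_cong[of _ _ "\<lambda>S. integral S w"]) (use t in auto)
  finally have I1: "integral {0..pi} (\<lambda>\<theta>. if 1 * (symbol \<xi> \<theta> - \<alpha>) \<le> 0 then w \<theta> else 0) = integral {0..?t} w" .
  have "integral {0..pi} (\<lambda>\<theta>. if - 1 * (symbol \<xi> \<theta> - \<alpha>) \<le> 0 then w \<theta> else 0) =
      integral {0..pi} (\<lambda>\<theta>. if \<theta> \<in> {?t..pi} then w \<theta> else 0)"
    by (rule Henstock_Kurzweil_Integration.integral_cong) (use le in auto)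
  also have "\<dots> = integral {?t..pi} w"
    unfolding integral_restrict_Int by (rule arg_cong[of _ _ "\<lambda>S. integral S w"]) (use t in auto)
  finally have I2: "integral {0..pi} (\<lambda>\<theta>. if - 1 * (symbol \<xi> \<theta> - \<alpha>) \<le> 0 then w \<theta> else 0) = integral {?t..pi} w" .
  have comb: "integral {0..?t} w + integral {?t..pi} w = integral {0..pi} w"
    by (intro Henstock_Kurzweil_Integration.integral_combine t integrable_continuous_interval w)
  show ?thesis
  proof (rule tendstoI)
    fix e :: real assume e: "e > 0"
    have pow: "q powi k \<le> 1" if "0 < q" "q < 1" "k \<in> {1..}" for q :: real and k
      using that by (auto simp: power_int_def power_le_one)
    have pow': "- 1 * q powi k \<le> - 1" if "0 < q" "q < 1" "k \<in> - {1..}" for q :: real and k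
      using that by (auto simp: power_int_def one_le_power one_le_inverse)
    have 1: "\<forall>\<^sub>F q in F. pi * ip {1..} (y q) (y q) < integral {0..?t} w + e"
      using half_line_limsup[OF y _ spec w e, of "{1..}" 1] pow unfolding I1 by simp
    have 2: "\<forall>\<^sub>F q in F. pi * ip (- {1..}) (y q) (y q) < integral {?t..pi} w + e"
      unfolding I2[symmetric] by (rule half_line_limsup[OF y pow' spec w e])
    have "\<forall>\<^sub>F q in F. l2 (y q)"
      using y by (auto simp: asymptotic_eigenfamily_def intro: bounded_family_l2)
    then show "\<forall>\<^sub>F q in F. dist (pi * ip {1..} (y q) (y q)) (integral {0..?t} w) < e"
      using 1 2 spec[of 1]
    proof eventually_elim
      case (elim q)
      have "pi * ip UNIV (y q) (y q) = integral {0..pi} w"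
        using elim(4) by (simp add: one_pCons integral_unique)
      moreover have "pi * ip UNIV (y q) (y q) = pi * ip {1..} (y q) (y q) + pi * ip (- {1..}) (y q) (y q)"
        unfolding ip_split[OF elim(1) elim(1), of "{1..}", symmetric] by (rule distrib_left)
      ultimately show ?case
        using elim(2,3) comb by (simp add: dist_real_def abs_less_iff)
    qed
  qed
qed

section \<open>Shifts of the Bessel coefficients as asymptotic eigenfamilies\<close>

definition coeff_family :: "int \<Rightarrow> real \<Rightarrow> int \<Rightarrow> real" where
  "coeff_family i q k = qbessel_coeff q \<xi> (N q + i + k)"

lemma coeff_family_l2:
  assumes "0 < q" "q < 1"
  shows "l2 (coeff_family i q)" "ip UNIV (coeff_family i q) (coeff_family i q) = 1"
proof -
  have o: "((\<lambda>m. qbessel_coeff q \<xi> m * qbessel_coeff q \<xi> m) has_sum 1) UNIV"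
    using qbessel_coeff_orthonormal[OF assms xi, of 0] by simp
  have "((\<lambda>k. coeff_family i q k * coeff_family i q k) has_sum 1) UNIV"
    using o has_sum_shift_int[of "\<lambda>m. qbessel_coeff q \<xi> m * qbessel_coeff q \<xi> m" "N q + i" 1]
    by (simp add: coeff_family_def add.commute)
  then show "l2 (coeff_family i q)" "ip UNIV (coeff_family i q) (coeff_family i q) = 1"
    by (auto simp: l2_def ip_def power2_eq_square dest: has_sum_imp_summable infsumI)
qed

lemma bounded_coeff_family: "bounded_family (coeff_family i)"
  unfolding bounded_family_def
  by (intro exI[of _ 1] eventually_mono[OF q_ev]) (auto simp: coeff_family_l2)

lemma asymptotic_eigenfamily_coeff: "asymptotic_eigenfamily (coeff_family i)"
proof -
  \<comment> \<open>\<open>e q\<close> accounts for the weight being centred at \<open>N q\<close>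
    while the coefficients are centred at \<open>N q + i\<close>; \<open>a1\<close> and
    \<open>a2\<close> collect the coefficients of the neighbours \<open>k + 1\<close> and
    \<open>k - 1\<close> in the residual. All three tend to 0.\<close>
  define e where "e = (\<lambda>q::real. 1 - q powi (- i))"
  define a1 where "a1 = (\<lambda>q. \<xi> * (1 / sqrt q - 1) - e q * (\<xi> / sqrt q))"
  define a2 where "a2 = (\<lambda>q. \<xi> * (sqrt q - 1) - e q * (\<xi> * sqrt q))"
  have sq: "((\<lambda>q. sqrt q) \<longlongrightarrow> 1) F"
    using tendsto_real_sqrt[OF q_lim] by simp
  have "((\<lambda>q. 1 - q powi (- i)) \<longlongrightarrow> 1 - 1 powi (- i)) F"
    by (intro tendsto_intros q_lim) auto
  then have e0: "(e \<longlongrightarrow> 0) F" by (simp add: e_def)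
  have a1: "(a1 \<longlongrightarrow> \<xi> * (1 / 1 - 1) - 0 * (\<xi> / 1)) F"
    unfolding a1_def by (intro tendsto_intros sq e0) auto
  have a2: "(a2 \<longlongrightarrow> \<xi> * (1 - 1) - 0 * (\<xi> * 1)) F"
    unfolding a2_def by (intro tendsto_intros sq e0)
  have "negligible_family (\<lambda>q k. (1 + \<xi>\<^sup>2) * (e q * coeff_family i q k) +
      1 * (1 * (a1 q * coeff_family i q (k + 1)) + 1 * (a2 q * coeff_family i q (k + (- 1)))))"
    by (intro negligible_family_lincomb negligible_family_scale bounded_family_shift bounded_coeff_family)
      (use a1 a2 e0 in auto)
  then have n: "negligible_family (\<lambda>q k. (1 + \<xi>\<^sup>2) * (e q * coeff_family i q k) +
      (a1 q * coeff_family i q (k + 1) + a2 q * coeff_family i q (k - 1)))"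
    by simp
  have "\<forall>\<^sub>F q in F. (\<lambda>k. (1 + \<xi>\<^sup>2) * (e q * coeff_family i q k) +
      (a1 q * coeff_family i q (k + 1) + a2 q * coeff_family i q (k - 1))) =
      (\<lambda>k. toeplitz \<xi> (coeff_family i q) k - weighted (coeff_family i) q k)"
    using q_ev
  proof eventually_elim
    case (elim q)
    show ?case
    proof
      fix k
      let ?c = "coeff_family i q"
      have "q powi (N q + k) = q powi (- i) * q powi (N q + i + k)"
        using elim power_int_add[of q "- i" "N q + i + k"] by (simp add: add_ac)
      then have "weighted (coeff_family i) q k =
          (1 - e q) * (q powi (N q + i + k) * qbessel_coeff q \<xi> (N q + i + k))"
        by (simp add: weighted_def coeff_family_def e_def)
      also have "\<dots> = (1 - e q) * ((1 + \<xi>\<^sup>2) * ?c k - \<xi> * (?c (k + 1) / sqrt q + sqrt q * ?c (k - 1)))"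
        using elim xi by (subst qbessel_coeff_recurrence) (auto simp: coeff_family_def add_ac add_diff_eq)
      finally have w: "weighted (coeff_family i) q k =
          (1 - e q) * ((1 + \<xi>\<^sup>2) * ?c k - \<xi> * (?c (k + 1) / sqrt q + sqrt q * ?c (k - 1)))" .
      show "(1 + \<xi>\<^sup>2) * (e q * ?c k) + (a1 q * ?c (k + 1) + a2 q * ?c (k - 1)) =
          toeplitz \<xi> ?c k - weighted (coeff_family i) q k"
        unfolding w toeplitz_def a1_def a2_def by (simp add: algebra_simps add_divide_distrib diff_divide_distrib)
    qed
  qed
  from negligible_family_cong[OF this n] show ?thesis
    using bounded_coeff_family by (simp add: asymptotic_eigenfamily_def)
qed

text \<open>The weight is the squared modulus of the trigonometric polynomial with coefficient
  \<open>a\<close> at frequency \<open>i\<close> and \<open>b\<close> at frequency \<open>j\<close>: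
  up to the factor \<open>1 / pi\<close>, the spectral density of \<open>y\<close> with respect to
  \<open>A\<close>.\<close>

lemma coeff_family_spectral:
  fixes a b :: real and i j :: int
  assumes q: "0 < q" "q < 1"
  defines "y \<equiv> \<lambda>k. a * coeff_family i q k + b * coeff_family j q k"
  shows "((\<lambda>\<theta>. poly p (symbol \<xi> \<theta>) * (a\<^sup>2 + b\<^sup>2 + 2 * a * b * cos (of_int (i - j) * \<theta>))) has_integral
    pi * ip UNIV (poly_toeplitz \<xi> p y) y) {0..pi}"
proof -
  let ?c = "\<lambda>i. coeff_family i q" and ?P = "poly_toeplitz \<xi> p"
  have I: "((\<lambda>\<theta>. poly p (symbol \<xi> \<theta>) * cos (of_int (m - n) * \<theta>)) has_integral
      pi * ip UNIV (?P (?c m)) (?c n)) {0..pi}" for m n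
    using poly_toeplitz_has_integral[OF qbessel_coeff_orthonormal[OF q xi], of p \<xi> "N q + m" "N q + n"]
    by (simp add: coeff_family_def[abs_def])
  have "ip UNIV (?P y) y = a * (a * ip UNIV (?P (?c i)) (?c i) + b * ip UNIV (?P (?c i)) (?c j)) +
      b * (a * ip UNIV (?P (?c j)) (?c i) + b * ip UNIV (?P (?c j)) (?c j))"
    unfolding y_def poly_toeplitz_lincomb
    by (simp only: ip_lincomb_left ip_lincomb_right l2_lincomb l2_poly_toeplitz coeff_family_l2 q)
  then have eq: "pi * ip UNIV (?P y) y =
      a * (a * (pi * ip UNIV (?P (?c i)) (?c i)) + b * (pi * ip UNIV (?P (?c i)) (?c j))) +
      b * (a * (pi * ip UNIV (?P (?c j)) (?c i)) + b * (pi * ip UNIV (?P (?c j)) (?c j)))"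
    by (simp add: algebra_simps)
  have cs: "cos (of_int (j - i) * \<theta>) = cos (of_int (i - j) * \<theta>)" for \<theta> :: real
    by (subst cos_minus[symmetric]) (simp add: algebra_simps)
  have "((\<lambda>\<theta>. a * (a * (poly p (symbol \<xi> \<theta>) * cos (of_int (i - i) * \<theta>)) + b * (poly p (symbol \<xi> \<theta>) * cos (of_int (i - j) * \<theta>))) +
      b * (a * (poly p (symbol \<xi> \<theta>) * cos (of_int (j - i) * \<theta>)) + b * (poly p (symbol \<xi> \<theta>) * cos (of_int (j - j) * \<theta>))))
      has_integral pi * ip UNIV (?P y) y) {0..pi}"
    unfolding eq by (intro has_integral_add has_integral_mult_right I)
  then show ?thesis
    unfolding cs by (simp add: algebra_simps power2_eq_square)
qed

text \<open>\<open>half_line_tendsto\<close> handles squared norms with a nonnegative weight;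
  polarization with \<open>b = 1\<close> and \<open>b = - 1\<close> gives the mixed inner
  product.\<close>

lemma coeff_family_tendsto:
  assumes \<kappa>: "\<kappa> = (1 + \<xi>\<^sup>2 - \<alpha>) / (2 * \<xi>)" "- 1 \<le> \<kappa>" "\<kappa> \<le> 1"
  shows "((\<lambda>q. pi * ip {1..} (coeff_family i q) (coeff_family j q)) \<longlongrightarrow>
    integral {0..arccos \<kappa>} (\<lambda>\<theta>. cos (of_int (i - j) * \<theta>))) F"
proof -
  let ?c = "coeff_family"
  define w :: "real \<Rightarrow> real \<Rightarrow> real \<Rightarrow> real" where
    "w = (\<lambda>a b \<theta>. a\<^sup>2 + b\<^sup>2 + 2 * a * b * cos (of_int (i - j) * \<theta>))"
  define y where "y = (\<lambda>a b q k. a * ?c i q k + b * ?c j q k)"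
  have w: "0 \<le> w a b \<theta>" "continuous_on S (w a b)" for a b \<theta> S
  proof -
    have "w a b \<theta> = (a + b * cos (of_int (i - j) * \<theta>))\<^sup>2 + (b * sin (of_int (i - j) * \<theta>))\<^sup>2"
      unfolding power_mult_distrib sin_squared_eq
      by (simp add: w_def power2_eq_square algebra_simps)
    then show "0 \<le> w a b \<theta>" by simp
    show "continuous_on S (w a b)" unfolding w_def by (intro continuous_intros)
  qed
  have lim: "((\<lambda>q. pi * ip {1..} (y a b q) (y a b q)) \<longlongrightarrow> integral {0..arccos \<kappa>} (w a b)) F" for a b
  proof (rule half_line_tendsto[OF _ _ w \<kappa>])
    show "asymptotic_eigenfamily (y a b)"
      unfolding y_def by (intro asymptotic_eigenfamily_lincomb asymptotic_eigenfamily_coeff)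
    show "\<forall>\<^sub>F q in F. ((\<lambda>\<theta>. poly p (symbol \<xi> \<theta>) * w a b \<theta>) has_integral
        pi * ip UNIV (poly_toeplitz \<xi> p (y a b q)) (y a b q)) {0..pi}" for p
      using q_ev by eventually_elim (use coeff_family_spectral in \<open>simp add: w_def y_def\<close>)
  qed
  have "((\<lambda>q. (pi * ip {1..} (y 1 1 q) (y 1 1 q) - pi * ip {1..} (y 1 (- 1) q) (y 1 (- 1) q)) / 4) \<longlongrightarrow>
      (integral {0..arccos \<kappa>} (w 1 1) - integral {0..arccos \<kappa>} (w 1 (- 1))) / 4) F"
    by (intro tendsto_intros lim) simp
  also have "(integral {0..arccos \<kappa>} (w 1 1) - integral {0..arccos \<kappa>} (w 1 (- 1))) =
      integral {0..arccos \<kappa>} (\<lambda>\<theta>. w 1 1 \<theta> - w 1 (- 1) \<theta>)"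
    by (rule Henstock_Kurzweil_Integration.integral_diff[symmetric])
      (intro integrable_continuous_interval w)+
  also have "\<dots> = 4 * integral {0..arccos \<kappa>} (\<lambda>\<theta>. cos (of_int (i - j) * \<theta>))"
    unfolding Henstock_Kurzweil_Integration.integral_mult_right[symmetric] by (simp add: w_def)
  finally have lim4: "((\<lambda>q. (pi * ip {1..} (y 1 1 q) (y 1 1 q) - pi * ip {1..} (y 1 (- 1) q) (y 1 (- 1) q)) / 4) \<longlongrightarrow>
      integral {0..arccos \<kappa>} (\<lambda>\<theta>. cos (of_int (i - j) * \<theta>))) F"
    by simp
  show ?thesis
  proof (rule Lim_transform_eventually[OF lim4])
    show "\<forall>\<^sub>F q in F. (pi * ip {1..} (y 1 1 q) (y 1 1 q) - pi * ip {1..} (y 1 (- 1) q) (y 1 (- 1) q)) / 4 =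
        pi * ip {1..} (?c i q) (?c j q)"
      using q_ev
    proof eventually_elim
      case (elim q)
      have "ip {1..} (y a b q) (y a b q) = a * (a * ip {1..} (?c i q) (?c i q) + b * ip {1..} (?c i q) (?c j q)) +
          b * (a * ip {1..} (?c i q) (?c j q) + b * ip {1..} (?c j q) (?c j q))" for a b
        unfolding y_def using elim
        by (simp only: ip_lincomb_left ip_lincomb_right l2_lincomb coeff_family_l2 ip_commute[of _ "?c j q" "?c i q"])
      then show ?case by (simp add: algebra_simps)
    qed
  qed
qed

end

section \<open>The half-integer lattice and the sine kernel\<close>

lemma half_integers_floor:
  assumes "r \<in> half_integers"
  shows "r = of_int \<lfloor>r\<rfloor> + 1 / 2"
proof -
  obtain m where m: "r - 1 / 2 = of_int m"
    using assms by (auto simp: half_integers_def elim: Ints_cases)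
  then have "\<lfloor>r\<rfloor> = m" by (intro floor_unique) auto
  then show ?thesis using m by simp
qed

text \<open>At the two ends of the bulk \<open>exp (- x)\<close> equals the maximum
  \<open>(1 + \<xi>)\<^sup>2\<close> and the minimum \<open>(1 - \<xi>)\<^sup>2\<close> of the
  symbol. In between it is a value of the symbol, at an angle whose cosine is the quotient in the
  conclusion.\<close>

lemma bulk_edge_bounds:
  fixes \<xi> x :: real
  assumes \<xi>: "0 < \<xi>" "\<xi> < 1" and x: "- 2 * ln (1 + \<xi>) \<le> x" "x \<le> - 2 * ln (1 - \<xi>)"
  shows "- 1 \<le> (1 + \<xi>\<^sup>2 - exp (- x)) / (2 * \<xi>)" "(1 + \<xi>\<^sup>2 - exp (- x)) / (2 * \<xi>) \<le> 1"
proof -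
  have e: "exp (2 * ln t) = t\<^sup>2" if "t > 0" for t :: real
    using that exp_of_nat_mult[of 2 "ln t"] by simp
  have "exp (- x) \<le> exp (2 * ln (1 + \<xi>))" "exp (2 * ln (1 - \<xi>)) \<le> exp (- x)"
    using x by auto
  then have "exp (- x) \<le> (1 + \<xi>)\<^sup>2" "(1 - \<xi>)\<^sup>2 \<le> exp (- x)"
    using e[of "1 + \<xi>"] e[of "1 - \<xi>"] \<xi> by auto
  then show "- 1 \<le> (1 + \<xi>\<^sup>2 - exp (- x)) / (2 * \<xi>)" "(1 + \<xi>\<^sup>2 - exp (- x)) / (2 * \<xi>) \<le> 1"
    using \<xi> by (auto simp: field_simps power2_eq_square)
qed

lemma integral_cos_interval:
  fixes c t :: real
  assumes "0 \<le> t"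
  shows "integral {0..t} (\<lambda>\<theta>. cos (c * \<theta>)) = (if c = 0 then t else sin (c * t) / c)"
proof (cases "c = 0")
  case True
  then show ?thesis
    using assms integral_unique[OF has_integral_const_real[of "1::real" 0 t]] by simp
next
  case False
  have "((\<lambda>\<theta>. cos (c * \<theta>)) has_integral (sin (c * t) / c - sin (c * 0) / c)) {0..t}"
    by (rule fundamental_theorem_of_calculus[OF assms])
      (use False in \<open>auto intro!: derivative_eq_intros simp flip: has_real_derivative_iff_has_vector_derivative\<close>)
  then show ?thesis using False by (simp add: integral_unique)
qed

theorem proposition2p7:
  fixes \<xi> a b x u v \<rho> :: real
  assumes "\<xi> \<in> {0..<1}" and "\<xi> \<noteq> 0"
    and "a = - 2 * ln (1 + \<xi>)" and "b = - 2 * ln (1 - \<xi>)"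
    and "x \<in> {a..b}"
    and "\<rho> = bulk_density \<xi> x"
  shows "\<rho> \<in> {0..1} \<and>
    ((\<lambda>q. q_bessel_kernel q \<xi> (- x / ln q + u) (- x / ln q + v)) \<longlongrightarrow>
      (if u \<noteq> v then sin (pi * \<rho> * (u - v)) / (pi * (u - v)) else \<rho>))
     (at 1 within bulk_scaling_domain x u v)"
proof
  have \<xi>: "0 < \<xi>" "\<xi> < 1" using assms(1,2) by auto
  define \<kappa> where "\<kappa> = (1 + \<xi>\<^sup>2 - exp (- x)) / (2 * \<xi>)"
  have \<kappa>: "- 1 \<le> \<kappa>" "\<kappa> \<le> 1"
    using bulk_edge_bounds[OF \<xi>, of x] assms by (auto simp: \<kappa>_def)
  \<comment> \<open>The argument of \<open>arccos\<close> in \<open>bulk_density\<close> is the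
    crossing cosine \<kappa>, so \<open>pi * \<rho>\<close> is the crossing angle.\<close>
  have "1 / 2 * (\<xi> + (1 - exp (- x)) / \<xi>) = \<kappa>"
    using \<xi> by (simp add: \<kappa>_def field_simps power2_eq_square)
  then have \<rho>: "pi * \<rho> = arccos \<kappa>"
    by (simp add: assms bulk_density_def)
  have bounds: "0 \<le> arccos \<kappa>" "arccos \<kappa> \<le> pi"
    using \<kappa> by (auto intro: arccos_lbound arccos_ubound)
  have "0 \<le> pi * \<rho>" "pi * \<rho> \<le> pi * 1" using bounds \<rho> by simp_all
  then show "\<rho> \<in> {0..1}"
    using pi_gt_zero by (auto simp: zero_le_mult_iff)
  define S where "S = bulk_scaling_domain x u v"
  define l where "l = (if u \<noteq> v then sin (pi * \<rho> * (u - v)) / (pi * (u - v)) else \<rho>)"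
  have S: "0 < q \<and> q < 1 \<and> - x / ln q + u \<in> half_integers \<and> - x / ln q + v \<in> half_integers" if "q \<in> S" for q
    using that by (auto simp: S_def bulk_scaling_domain_def)
  have ev_S: "\<forall>\<^sub>F q in at 1 within S. q \<in> S"
    by (simp add: eventually_at_filter)
  show "((\<lambda>q. q_bessel_kernel q \<xi> (- x / ln q + u) (- x / ln q + v)) \<longlongrightarrow>
      (if u \<noteq> v then sin (pi * \<rho> * (u - v)) / (pi * (u - v)) else \<rho>)) (at 1 within bulk_scaling_domain x u v)"
    unfolding S_def[symmetric] l_def[symmetric]
  proof (cases "S = {}")
    \<comment> \<open>Without any admissible \<open>q\<close> the filter is trivial.\<close>
    case True
    then show "((\<lambda>q. q_bessel_kernel q \<xi> (- x / ln q + u) (- x / ln q + v)) \<longlongrightarrow> l) (at 1 within S)"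
      by simp
  next
    case False
    then obtain q0 where q0: "q0 \<in> S" by blast
    \<comment> \<open>One admissible \<open>q0\<close> already forces \<open>v - u\<close> to be an
      integer, and this same \<open>d\<close> relates the two lattice points for every other
      \<open>q\<close> in \<open>S\<close>.\<close>
    define d where "d = \<lfloor>- x / ln q0 + v\<rfloor> - \<lfloor>- x / ln q0 + u\<rfloor>"
    have d: "v = u + of_int d"
      using half_integers_floor[of "- x / ln q0 + u"] half_integers_floor[of "- x / ln q0 + v"] S[OF q0]
      by (simp add: d_def)
    define N where "N = (\<lambda>q. \<lfloor>- x / ln q + u\<rfloor>)"
    have N: "- x / ln q + u = of_int (N q) + 1 / 2" "- x / ln q + v = of_int (N q + d) + 1 / 2"
      if "q \<in> S" for q
      using half_integers_floor[of "- x / ln q + u"] S[OF that] d by (simp_all add: N_def)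
    interpret bulk_limit "at 1 within S" \<xi> "exp (- x)" N
    proof
      show "\<forall>\<^sub>F q in at 1 within S. 0 < q \<and> q < 1"
        using ev_S by eventually_elim (use S in blast)
      show "((\<lambda>q. q powi N q) \<longlongrightarrow> exp (- x)) (at 1 within S)"
      proof (rule Lim_transform_eventually)
        \<comment> \<open>On \<open>S\<close> this is exactly \<open>q powi N q\<close>, because
          multiplying the equation for \<open>N q\<close> by \<open>ln q\<close> cancels the
          denominator of \<open>- x / ln q\<close>.\<close>
        have "((\<lambda>q. exp (- x + (u - 1 / 2) * ln q)) \<longlongrightarrow> exp (- x + (u - 1 / 2) * ln 1)) (at 1 within S)"
          by (intro tendsto_intros) auto
        then show "((\<lambda>q. exp (- x + (u - 1 / 2) * ln q)) \<longlongrightarrow> exp (- x)) (at 1 within S)" by simp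
        show "\<forall>\<^sub>F q in at 1 within S. exp (- x + (u - 1 / 2) * ln q) = q powi N q"
          using ev_S
        proof eventually_elim
          case (elim q)
          have q: "0 < q" "ln q \<noteq> 0" using S[OF elim] by auto
          have "of_int (N q) = - x / ln q + u - 1 / 2" using N(1)[OF elim] by simp
          then have "of_int (N q) * ln q = - x + (u - 1 / 2) * ln q"
            using q by (simp add: field_simps)
          moreover have "q powi N q = exp (of_int (N q) * ln q)"
            using q powr_real_of_int'[of q "N q"] by (simp add: powr_def)
          ultimately show ?case by simp
        qed
      qed
    qed (use \<xi> in auto)
    have "((\<lambda>q. 1 / pi * (pi * ip {1..} (coeff_family 0 q) (coeff_family d q))) \<longlongrightarrow>
        1 / pi * integral {0..arccos \<kappa>} (\<lambda>\<theta>. cos (of_int (0 - d) * \<theta>))) (at 1 within S)"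
      by (intro tendsto_mult tendsto_const coeff_family_tendsto \<kappa>) (simp add: \<kappa>_def)
    \<comment> \<open>Here the sine kernel appears: \<open>0 - d\<close> is \<open>u - v\<close>,
      and \<open>d = 0\<close> gives the length \<open>pi * \<rho>\<close> of the interval, hence
      the diagonal value.\<close>
    also have "1 / pi * integral {0..arccos \<kappa>} (\<lambda>\<theta>. cos (of_int (0 - d) * \<theta>)) = l"
      unfolding integral_cos_interval[OF bounds(1)] by (simp add: l_def d \<rho>[symmetric] mult_ac)
    finally have lim: "((\<lambda>q. 1 / pi * (pi * ip {1..} (coeff_family 0 q) (coeff_family d q))) \<longlongrightarrow> l) (at 1 within S)" .
    show "((\<lambda>q. q_bessel_kernel q \<xi> (- x / ln q + u) (- x / ln q + v)) \<longlongrightarrow> l) (at 1 within S)"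
    proof (rule Lim_transform_eventually[OF lim])
      show "\<forall>\<^sub>F q in at 1 within S. 1 / pi * (pi * ip {1..} (coeff_family 0 q) (coeff_family d q)) =
          q_bessel_kernel q \<xi> (- x / ln q + u) (- x / ln q + v)"
        using ev_S
      proof eventually_elim
        case (elim q)
        then show ?case
          using S[OF elim] unfolding N[OF elim]
          by (subst q_bessel_kernel_eq[OF _ _ \<xi>]) (auto simp: ip_def coeff_family_def)
      qed
    qed
  qed
qed

end
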